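(* Let $s \ge 2$ be an integer. Define a sequence $(a_t)_{t\ge 0}$ of positive real numbers recursively by $$a_t = \begin{cases} 1 & \text{if } r_t(3) \le s,\\[2pt] \dfrac12 & \text{if } r_{t-1}(3) \le s < r_t(3),\\[6pt] \dfrac{s + \lceil s/2\rceil - 3}{2s + 2\lceil s/2\rceil - 5} & \text{if } r_{t-2}(3) \le s < r_{t-1}(3) \text{ and } s \ge 3,\end{cases}$$ and $$\frac{1}{a_t} = 1 + \frac{1}{s-1}\sum_{i=2}^{s} \frac{1}{a_{t-g(i)}} \qquad \text{if } 3 \le s < r_{t-2}(3) \text{ or } 2 = s < r_{t-1}(3).$$ Then for every integer $t \ge 1$, $$f_{\alpha_s; K_3,\ldots,K_3}(n) \ge \Omega(n^{a_t}) \quad (n \to \infty),$$ where $K_3$ appears exactly $t$ times in the subscript and the implied constant may depend on $s$ and $t$.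
   Context: For a graph $G$, $\alpha_s(G)$ is the maximum size of a vertex subset that induces no copy of $K_s$. A graph $G$ is $(K_3,\ldots,K_3)$-free ($t$ entries) if $E(G)$ can be colored with $t$ colors so that there is no monochromatic triangle. The function $f_{\alpha_s;K_3,\ldots,K_3}(n)$ ($t$ copies of $K_3$) is the minimum of $\alpha_s(G)$ over all $(K_3,\ldots,K_3)$-free ($t$ entries) graphs $G$ with $n$ vertices. The multicolor Ramsey number $r_t(3)$ is the smallest integer $m$ such that every coloring of $E(K_m)$ with $t$ colors contains a monochromatic triangle; $r_0(3)=2$. Conditions involving $r_{j}(3)$ with $j<0$ are regarded as not applicable. The local Ramsey number $r^{\mathrm{loc}}_k(3)$ is the smallest integer $m$ such that every edge-coloring of $K_m$ with colors from $\mathbb{N}$, in which each vertex is incident to edges of at most $k$ distinct colors, contains a monochromatic triangle; $r^{\mathrm{loc}}_0(3)=2$. The function $g$ is defined by: $g(i)$ is the smallest integer $k$ such that $r^{\mathrm{loc}}_k(3) > i$. (For instance $g(2)=1$, $g(3)=g(4)=g(5)=2$, $g(6)=3$.) In the recursion the indices $t-g(i)$ are always non-negative, because $r^{\mathrm{loc}}_t(3)\ge r_t(3) > s$ there. *)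

theory Defs
  imports Complex_Main "HOL-Library.Ramsey" "HOL-Library.Landau_Symbols"
begin

text \<open>
  A finite simple graph is a finite vertex set \<open>V\<close> together with an edge set
  \<open>E \<subseteq> nsets V 2\<close>. An edge coloring is a function on edges, of which only the values on
  \<open>E\<close> matter.
\<close>

definition mono_triangle :: "'a set set \<Rightarrow> ('a set \<Rightarrow> nat) \<Rightarrow> bool" where
  "mono_triangle E c \<longleftrightarrow>
     (\<exists>x y z. distinct [x, y, z] \<and> {x, y} \<in> E \<and> {y, z} \<in> E \<and> {x, z} \<in> E \<and>
              c {x, y} = c {y, z} \<and> c {y, z} = c {x, z})"

definition K3_free_colorable :: "nat \<Rightarrow> 'a set set \<Rightarrow> bool" where
  "K3_free_colorable t E \<longleftrightarrow> (\<exists>c \<in> E \<rightarrow> {..<t}. \<not> mono_triangle E c)"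

definition alpha :: "nat \<Rightarrow> 'a set \<Rightarrow> 'a set set \<Rightarrow> nat" where
  "alpha s V E = Max (card ` {S. S \<subseteq> V \<and> \<not> (\<exists>K \<in> nsets S s. clique K E)})"

text \<open>All graphs on \<open>n\<close> vertices are represented, up to isomorphism, on \<open>{..<n}\<close>.\<close>

definition f_alpha :: "nat \<Rightarrow> nat \<Rightarrow> nat \<Rightarrow> nat" where
  "f_alpha s t n = Min (alpha s {..<n} ` {E. E \<subseteq> nsets {..<n} 2 \<and> K3_free_colorable t E})"

definition ramsey3 :: "nat \<Rightarrow> nat" where
  "ramsey3 t = (LEAST m. \<forall>c \<in> nsets {..<m} 2 \<rightarrow> {..<t}. mono_triangle (nsets {..<m} 2) c)"

definition local_coloring :: "nat \<Rightarrow> 'a set \<Rightarrow> ('a set \<Rightarrow> nat) \<Rightarrow> bool" where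
  "local_coloring k V c \<longleftrightarrow> (\<forall>v\<in>V. card (c ` {e \<in> nsets V 2. v \<in> e}) \<le> k)"

definition local_ramsey3 :: "nat \<Rightarrow> nat" where
  "local_ramsey3 k =
     (LEAST m. \<forall>c. local_coloring k {..<m} c \<longrightarrow> mono_triangle (nsets {..<m} 2) c)"

definition g_loc :: "nat \<Rightarrow> nat" where
  "g_loc i = (LEAST k. local_ramsey3 k > i)"

lemma mono_triangle_mono: "mono_triangle E c \<Longrightarrow> E \<subseteq> F \<Longrightarrow> mono_triangle F c"
  unfolding mono_triangle_def by blast

lemma local_coloring_bound:
  "\<exists>N. \<forall>(V::'a set) c. finite V \<longrightarrow> card V \<ge> N \<longrightarrow> local_coloring k V c \<longrightarrow>
         mono_triangle (nsets V 2) c"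
proof (induction k)
  case 0
  have False if fin: "finite V" and card: "card V \<ge> 2" and loc: "local_coloring 0 V c"
    for V :: "'a set" and c
  proof -
    have "\<not> card V \<le> Suc 0"
      using card by simp
    then obtain x y where xy: "x \<in> V" "y \<in> V" "x \<noteq> y"
      unfolding card_le_Suc0_iff_eq[OF fin] by blast
    have "finite {e \<in> nsets V 2. x \<in> e}"
      using fin by (simp add: finite_imp_finite_nsets)
    moreover have "{x, y} \<in> {e \<in> nsets V 2. x \<in> e}"
      using xy by simp
    ultimately have "card (c ` {e \<in> nsets V 2. x \<in> e}) > 0"
      by (subst card_gt_0_iff) blast
    thus False
      using loc xy(1) by (auto simp: local_coloring_def)
  qed
  thus ?case by blast
next
  case (Suc k)
  then obtain N where N: "\<And>(V::'a set) c. finite V \<Longrightarrow> card V \<ge> N \<Longrightarrow>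
      local_coloring k V c \<Longrightarrow> mono_triangle (nsets V 2) c"
    by blast
  have "mono_triangle (nsets V 2) c"
    if fin: "finite V" and card: "card V \<ge> Suc k * N + 2" and loc: "local_coloring (Suc k) V c"
    for V :: "'a set" and c
  proof -
    from card obtain v where v: "v \<in> V"
      by fastforce
    define C where "C = c ` {e \<in> nsets V 2. v \<in> e}"
    define B where "B i = {w \<in> V - {v}. c {v, w} = i}" for i
    have finC: "finite C" and cardC: "card C \<le> Suc k"
      using fin loc v by (auto simp: C_def local_coloring_def finite_imp_finite_nsets)
    have "c {v, w} \<in> C" if "w \<in> V - {v}" for w
      unfolding C_def using v that by (intro imageI) auto
    hence "V - {v} \<subseteq> (\<Union>i\<in>C. B i)"
      by (auto simp: B_def)
    hence "card (V - {v}) \<le> card (\<Union>i\<in>C. B i)"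
      using fin finC by (intro card_mono) (auto simp: B_def)
    also have "\<dots> \<le> (\<Sum>i\<in>C. card (B i))"
      by (rule card_UN_le[OF finC])
    finally have sum: "card (V - {v}) \<le> (\<Sum>i\<in>C. card (B i))" .
    have "\<exists>i\<in>C. card (B i) \<ge> N"
    proof (rule ccontr)
      assume "\<not> ?thesis"
      hence "(\<Sum>i\<in>C. card (B i)) \<le> card C * N"
        by (intro sum_bounded_above[where K = N, simplified]) (auto simp: not_le)
      also have "\<dots> \<le> Suc k * N"
        by (rule mult_le_mono1[OF cardC])
      finally show False
        using sum card v fin by simp
    qed
    then obtain i where i: "card (B i) \<ge> N"
      by blast
    have finB: "finite (B i)"
      using fin by (simp add: B_def)
    have sub: "nsets (B i) 2 \<subseteq> nsets V 2"
      by (rule nsets_mono) (auto simp: B_def)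
    show ?thesis
    proof (cases "\<exists>e \<in> nsets (B i) 2. c e = i")
      case True
      then obtain x y where "x \<in> B i" "y \<in> B i" "x \<noteq> y" "c {x, y} = i"
        by (auto simp: nsets_2_eq)
      thus ?thesis
        unfolding mono_triangle_def using v
        by (intro exI[of _ v] exI[of _ x] exI[of _ y]) (auto simp: B_def)
    next
      case False
      have "local_coloring k (B i) c"
        unfolding local_coloring_def
      proof
        fix w assume w: "w \<in> B i"
        define D where "D = c ` {e \<in> nsets V 2. w \<in> e}"
        have finD: "finite D"
          using fin by (simp add: D_def finite_imp_finite_nsets)
        have "c ` {e \<in> nsets (B i) 2. w \<in> e} \<subseteq> D - {i}"
          using sub False by (auto simp: D_def)
        hence "card (c ` {e \<in> nsets (B i) 2. w \<in> e}) \<le> card (D - {i})"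
          using finD by (intro card_mono) auto
        also have "i \<in> D"
          using w v unfolding D_def B_def
          by (intro image_eqI[of _ _ "{v, w}"]) auto
        hence "card (D - {i}) \<le> k"
          using finD loc w by (auto simp: D_def B_def local_coloring_def)
        finally show "card (c ` {e \<in> nsets (B i) 2. w \<in> e}) \<le> k" .
      qed
      from N[OF finB i this] show ?thesis
        using sub by (rule mono_triangle_mono)
    qed
  qed
  thus ?case by blast
qed

lemma local_ramsey3_ex:
  "\<exists>m::nat. \<forall>c. local_coloring k {..<m} c \<longrightarrow> mono_triangle (nsets {..<m} 2) c"
  using local_coloring_bound[of k, where 'a = nat] by (metis card_lessThan finite_lessThan order_refl)

lemma local_ramsey3_works:
  "local_coloring k {..<local_ramsey3 k} c \<Longrightarrow> mono_triangle (nsets {..<local_ramsey3 k} 2) c"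
  using LeastI_ex[OF local_ramsey3_ex[of k]] unfolding local_ramsey3_def by blast

lemma Pi_imp_local_coloring:
  assumes "c \<in> nsets V 2 \<rightarrow> {..<t}"
  shows   "local_coloring t V c"
  unfolding local_coloring_def
proof
  fix v assume "v \<in> V"
  have "card (c ` {e \<in> nsets V 2. v \<in> e}) \<le> card {..<t}"
    using assms by (intro card_mono) auto
  thus "card (c ` {e \<in> nsets V 2. v \<in> e}) \<le> t"
    by simp
qed

lemma ramsey3_ex:
  "\<exists>m::nat. \<forall>c \<in> nsets {..<m} 2 \<rightarrow> {..<t}. mono_triangle (nsets {..<m} 2) c"
  using local_ramsey3_works Pi_imp_local_coloring by blast

lemma ramsey3_works:
  "c \<in> nsets {..<ramsey3 t} 2 \<rightarrow> {..<t} \<Longrightarrow> mono_triangle (nsets {..<ramsey3 t} 2) c"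
  using LeastI_ex[OF ramsey3_ex[of t]] unfolding ramsey3_def by blast

lemma ramsey3_le_local_ramsey3: "ramsey3 t \<le> local_ramsey3 t"
  unfolding ramsey3_def
  by (rule Least_le) (use local_ramsey3_works Pi_imp_local_coloring in blast)

lemma ramsey3_mono: "t \<le> u \<Longrightarrow> ramsey3 t \<le> ramsey3 u"
  unfolding ramsey3_def[of t]
proof (rule Least_le, rule ballI)
  fix c :: "nat set \<Rightarrow> nat"
  assume "t \<le> u" "c \<in> nsets {..<ramsey3 u} 2 \<rightarrow> {..<t}"
  hence "c \<in> nsets {..<ramsey3 u} 2 \<rightarrow> {..<u}"
    unfolding Pi_iff lessThan_iff by (blast intro: less_le_trans)
  thus "mono_triangle (nsets {..<ramsey3 u} 2) c"
    by (rule ramsey3_works)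
qed

lemma local_ramsey3_gt: "local_ramsey3 k > k"
proof (rule ccontr)
  assume "\<not> ?thesis"
  hence le: "local_ramsey3 k \<le> k" by simp
  define V where "V = {..<local_ramsey3 k}"
  obtain c :: "nat set \<Rightarrow> nat" where inj: "inj_on c (nsets V 2)"
    using finite_imp_inj_to_nat_seg[of "nsets V 2"] by (auto simp: V_def finite_imp_finite_nsets)
  have "local_coloring k V c"
    unfolding local_coloring_def
  proof
    fix v assume v: "v \<in> V"
    have "c ` {e \<in> nsets V 2. v \<in> e} \<subseteq> (\<lambda>w. c {v, w}) ` V"
      by (auto simp: nsets_2_eq insert_commute)
    hence "card (c ` {e \<in> nsets V 2. v \<in> e}) \<le> card V"
      using surj_card_le[of V] by (simp add: V_def)
    thus "card (c ` {e \<in> nsets V 2. v \<in> e}) \<le> k"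
      using le by (simp add: V_def)
  qed
  hence "mono_triangle (nsets V 2) c"
    using local_ramsey3_works by (simp add: V_def)
  then obtain x y z where "distinct [x, y, z]" "{x, y} \<in> nsets V 2" "{y, z} \<in> nsets V 2"
      "c {x, y} = c {y, z}"
    unfolding mono_triangle_def by blast
  thus False
    using inj_onD[OF inj, of "{x, y}" "{y, z}"] by (simp add: doubleton_eq_iff)
qed

lemma local_ramsey3_g_loc: "local_ramsey3 (g_loc i) > i"
  unfolding g_loc_def by (rule LeastI[of _ i]) (rule local_ramsey3_gt)

lemma local_ramsey3_0: "local_ramsey3 0 = 2"
  unfolding local_ramsey3_def
proof (rule Least_equality)
  have "\<not> local_coloring 0 {..<2::nat} c" for c
  proof
    assume "local_coloring 0 {..<2::nat} c"
    hence "{e \<in> nsets {..<2::nat} 2. 0 \<in> e} = {}"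
      by (auto simp: local_coloring_def)
    thus False
      by auto
  qed
  thus "\<forall>c. local_coloring 0 {..<2::nat} c \<longrightarrow> mono_triangle (nsets {..<2} 2) c"
    by blast
next
  fix m :: nat
  assume *: "\<forall>c. local_coloring 0 {..<m} c \<longrightarrow> mono_triangle (nsets {..<m} 2) c"
  show "2 \<le> m"
  proof (rule ccontr)
    assume "\<not> 2 \<le> m"
    hence "nsets {..<m} 2 = {}"
      by (intro nsets_eq_empty) auto
    thus False
      using * by (auto simp: local_coloring_def mono_triangle_def)
  qed
qed

lemma ramsey3_0: "ramsey3 0 = 2"
proof (rule antisym)
  show "ramsey3 0 \<le> 2"
    using ramsey3_le_local_ramsey3[of 0] by (simp add: local_ramsey3_0)
  show "2 \<le> ramsey3 0"
  proof (rule ccontr)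
    assume "\<not> ?thesis"
    hence "nsets {..<ramsey3 0} 2 = {}"
      by (intro nsets_eq_empty) auto
    thus False
      using ramsey3_works[of _ 0] by (auto simp: mono_triangle_def)
  qed
qed

lemma g_loc_pos: "i \<ge> 2 \<Longrightarrow> g_loc i > 0"
  using local_ramsey3_g_loc[of i] local_ramsey3_0 by (cases "g_loc i = 0") auto

lemma g_loc_le: "i < ramsey3 t \<Longrightarrow> g_loc i \<le> t"
  unfolding g_loc_def by (rule Least_le) (use ramsey3_le_local_ramsey3[of t] in simp)

text \<open>
  The guards \<open>t \<ge> 1\<close> and \<open>t \<ge> 2\<close> express that conditions on \<open>ramsey3 j\<close> with \<open>j < 0\<close> do not
  apply. By \<open>g_loc_le\<close>, the subtraction \<open>t - g_loc i\<close> does not truncate. For \<open>s \<ge> 2\<close> the last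
  branch is never reached, and the four others are mutually exclusive; see the equations below.
\<close>

function a_seq :: "nat \<Rightarrow> nat \<Rightarrow> real" where
  "a_seq s t =
     (if ramsey3 t \<le> s then 1
      else if t \<ge> 1 \<and> ramsey3 (t - 1) \<le> s \<and> s < ramsey3 t then 1 / 2
      else if t \<ge> 2 \<and> ramsey3 (t - 2) \<le> s \<and> s < ramsey3 (t - 1) \<and> s \<ge> 3 then
        (real s + \<lceil>real s / 2\<rceil> - 3) / (2 * real s + 2 * \<lceil>real s / 2\<rceil> - 5)
      else if (t \<ge> 2 \<and> 3 \<le> s \<and> s < ramsey3 (t - 2)) \<or> (t \<ge> 1 \<and> s = 2 \<and> s < ramsey3 (t - 1)) then
        1 / (1 + 1 / (real s - 1) * (\<Sum>i = 2..s. 1 / a_seq s (t - g_loc i)))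
      else 0)"
  by pat_completeness auto
termination
  by (relation "measure snd") (auto dest: g_loc_pos)

declare a_seq.simps [simp del]

lemma a_seq_pos: "s \<ge> 2 \<Longrightarrow> a_seq s t > 0"
proof (induction t rule: less_induct)
  case (less t)
  have cases: "ramsey3 t \<le> s \<or> (t \<ge> 1 \<and> ramsey3 (t - 1) \<le> s) \<or>
      (t \<ge> 2 \<and> ramsey3 (t - 2) \<le> s \<and> s \<ge> 3) \<or>
      (t \<ge> 2 \<and> 3 \<le> s \<and> s < ramsey3 (t - 2)) \<or> (t \<ge> 1 \<and> s = 2 \<and> s < ramsey3 (t - 1))"
    using less.prems ramsey3_0 by (cases "t = 0"; cases "t = 1") auto
  have frac: "(real s + \<lceil>real s / 2\<rceil> - 3) / (2 * real s + 2 * \<lceil>real s / 2\<rceil> - 5) > 0"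
    if "s \<ge> 3"
    using that by (intro divide_pos_pos; linarith)
  have rec: "1 / (1 + 1 / (real s - 1) * (\<Sum>i = 2..s. 1 / a_seq s (t - g_loc i))) > 0" if "t \<ge> 1"
  proof -
    have "(\<Sum>i = 2..s. 1 / a_seq s (t - g_loc i)) \<ge> 0"
    proof (rule sum_nonneg)
      fix i assume "i \<in> {2..s}"
      hence "a_seq s (t - g_loc i) > 0"
        using that g_loc_pos[of i] less by simp
      thus "1 / a_seq s (t - g_loc i) \<ge> 0" by simp
    qed
    hence "1 / (real s - 1) * (\<Sum>i = 2..s. 1 / a_seq s (t - g_loc i)) \<ge> 0"
      using less.prems by (intro mult_nonneg_nonneg) auto
    thus ?thesis
      by (intro divide_pos_pos) linarith+
  qed
  show ?case
    using cases frac rec by (subst a_seq.simps) auto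
qed

lemma a_seq_eq_1: "ramsey3 t \<le> s \<Longrightarrow> a_seq s t = 1"
  by (subst a_seq.simps) simp

lemma a_seq_eq_half: "t \<ge> 1 \<Longrightarrow> ramsey3 (t - 1) \<le> s \<Longrightarrow> s < ramsey3 t \<Longrightarrow> a_seq s t = 1 / 2"
  by (subst a_seq.simps) simp

lemma a_seq_eq_frac:
  assumes "t \<ge> 2" "ramsey3 (t - 2) \<le> s" "s < ramsey3 (t - 1)" "s \<ge> 3"
  shows   "a_seq s t = (real s + \<lceil>real s / 2\<rceil> - 3) / (2 * real s + 2 * \<lceil>real s / 2\<rceil> - 5)"
  using assms ramsey3_mono[of "t - 1" t] by (subst a_seq.simps) simp

lemma a_seq_eq_rec:
  assumes "(t \<ge> 2 \<and> 3 \<le> s \<and> s < ramsey3 (t - 2)) \<or> (t \<ge> 1 \<and> s = 2 \<and> s < ramsey3 (t - 1))"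
  shows   "1 / a_seq s t = 1 + 1 / (real s - 1) * (\<Sum>i = 2..s. 1 / a_seq s (t - g_loc i))"
    and   "i \<in> {2..s} \<Longrightarrow> g_loc i \<le> t"
proof -
  have "ramsey3 (t - 2) \<le> ramsey3 (t - 1)" "ramsey3 (t - 1) \<le> ramsey3 t"
    by (rule ramsey3_mono, simp)+
  hence lt: "s < ramsey3 t" "s < ramsey3 (t - 1)"
    using assms by linarith+
  show "1 / a_seq s t = 1 + 1 / (real s - 1) * (\<Sum>i = 2..s. 1 / a_seq s (t - g_loc i))"
    using assms lt by (subst a_seq.simps) auto
  show "g_loc i \<le> t" if "i \<in> {2..s}"
    using that lt by (intro g_loc_le) auto
qed

end

theory Submission
  imports Defs
begin

text \<open>
  Let \<open>M\<close> be the largest size of a set inducing no \<open>K\<^sub>s\<close>. If a set of colours is avoided on \<open>N\<close>,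
  then \<open>N\<close> spans a graph coloured with fewer colours, so \<open>card N\<close> is bounded by a power of \<open>M\<close>. In
  particular this holds for the common neighbourhood of a clique \<open>Q\<close> along a given pattern of
  colours, since no edge inside it can have one of the colours of the pattern. As every \<open>i\<close>-clique
  has a vertex that sees at least \<open>g(i)\<close> colours on the others, building cliques vertex by vertex
  bounds the number of copies of \<open>K\<^sub>s\<close>, and a random sparsification of the vertex set turns this
  into the recursive lower bound for \<open>M\<close>.

  In the case \<open>r\<^sub>t\<^sub>-\<^sub>2(3) \<le> s < r\<^sub>t\<^sub>-\<^sub>1(3)\<close> there is a gain. If most vertices have small degree in every
  colour, there are few first edges to start from. Otherwise many vertices have large degree in one
  colour \<open>a\<close>; since two vertices have at most \<open>M\<close> common neighbours along two distinct colours, they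
  have small degree in the other colours on average. Among these vertices one destroys the
  \<open>a\<close>-free cliques of size \<open>m = \<lceil>s/2\<rceil>\<close> and the remaining \<open>s\<close>-cliques. Both can be built from an
  edge whose colour is not \<open>a\<close>: an \<open>s\<close>-clique without \<open>a\<close>-free \<open>m\<close>-subset is not complete bipartite
  in colour \<open>a\<close> and hence contains a triangle with exactly one edge of colour \<open>a\<close>.
\<close>

section \<open>Clique-free sets and the bound to be proved by induction on \<open>t\<close>\<close>

definition clique_free :: "nat \<Rightarrow> 'a set \<Rightarrow> 'a set set \<Rightarrow> bool" where
  "clique_free s S E \<longleftrightarrow> \<not> (\<exists>K \<in> nsets S s. clique K E)"

text \<open>The exponent \<open>e\<close> plays the role of \<open>1 / a\<^sub>t\<close>.\<close>

definition alpha_bound :: "nat \<Rightarrow> nat \<Rightarrow> real \<Rightarrow> real \<Rightarrow> bool" where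
  "alpha_bound s t e C \<longleftrightarrow> C > 0 \<and> (\<forall>(V::nat set) E M. finite V \<longrightarrow> E \<subseteq> nsets V 2 \<longrightarrow>
     K3_free_colorable t E \<longrightarrow> M \<ge> 1 \<longrightarrow> (\<forall>S\<subseteq>V. clique_free s S E \<longrightarrow> real (card S) \<le> M) \<longrightarrow>
     real (card V) \<le> C * M powr e)"

subsection \<open>Random sparsification\<close>

lemma card_PiE_constant_on:
  assumes "finite V" "e \<subseteq> V"
  shows "card {f \<in> V \<rightarrow>\<^sub>E {..<k}. \<exists>j<k. \<forall>x\<in>e. f x = j} \<le> k * k ^ (card V - card e)"
proof -
  let ?P = "\<lambda>j. Pi\<^sub>E V (\<lambda>x. if x \<in> e then {j} else {..<k})"
  have fin: "finite e" using assms finite_subset by blast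
  have "{f \<in> V \<rightarrow>\<^sub>E {..<k}. \<exists>j<k. \<forall>x\<in>e. f x = j} \<subseteq> (\<Union>j<k. ?P j)"
    by (auto simp: PiE_iff)
  hence "card {f \<in> V \<rightarrow>\<^sub>E {..<k}. \<exists>j<k. \<forall>x\<in>e. f x = j} \<le> card (\<Union>j<k. ?P j)"
    using assms by (intro card_mono) (auto intro!: finite_PiE)
  also have "\<dots> \<le> (\<Sum>j<k. card (?P j))"
    by (rule card_UN_le) simp
  also have "\<dots> = (\<Sum>j<k. k ^ (card V - card e))"
  proof (rule sum.cong[OF refl])
    fix j
    have "card (?P j) = (\<Prod>x\<in>V. if x \<in> e then 1 else k)"
      unfolding card_PiE[OF assms(1)] by (rule prod.cong) auto
    also have "\<dots> = (\<Prod>x\<in>V - e. k)"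
      using assms by (simp add: prod.If_cases Diff_eq)
    finally show "card (?P j) = k ^ (card V - card e)"
      using assms fin by (simp add: card_Diff_subset)
  qed
  finally show ?thesis by simp
qed

text \<open>Colour \<open>V\<close> uniformly at random with \<open>k\<close> colours, and delete one vertex from each
  monochromatic member of \<open>H\<close>.\<close>

lemma card_le_of_transversals:
  fixes M :: real
  assumes V: "finite V" and H: "H \<subseteq> Pow V" "{} \<notin> H" and k: "k \<ge> 1"
    and M: "\<And>S. S \<subseteq> V \<Longrightarrow> (\<forall>e\<in>H. \<not> e \<subseteq> S) \<Longrightarrow> real (card S) \<le> M"
  shows "real (card V) \<le> real k * M + (\<Sum>e\<in>H. (1 / real k) ^ (card e - 1))"
proof -
  define F where "F = V \<rightarrow>\<^sub>E {..<k}"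
  define mono where "mono f e \<longleftrightarrow> (\<exists>j<k. \<forall>x\<in>e. f x = j)" for f :: "'a \<Rightarrow> nat" and e
  define X where "X = (\<Sum>e\<in>H. (1 / real k) ^ (card e - 1))"
  have finH: "finite H" using H V by (meson finite_Pow_iff finite_subset)
  have finF: "finite F" using V unfolding F_def by (intro finite_PiE) auto
  have cardF: "card F = k ^ card V" unfolding F_def using V by (simp add: card_PiE)
  \<comment> \<open>This sum is \<open>card F\<close> times the expected number of monochromatic
    members of \<open>H\<close>: a set \<open>e\<close> is monochromatic with probability at most
    \<open>(1 / k) ^ (card e - 1)\<close>.\<close>
  have "(\<Sum>f\<in>F. real (card {e\<in>H. mono f e})) = (\<Sum>f\<in>F. \<Sum>e\<in>H. if mono f e then 1 else 0)"
    using finH by (simp add: sum.If_cases Int_def)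
  also have "\<dots> = (\<Sum>e\<in>H. \<Sum>f\<in>F. if mono f e then 1 else 0)"
    by (rule sum.swap)
  also have "\<dots> = (\<Sum>e\<in>H. real (card {f\<in>F. mono f e}))"
    using finF by (simp add: sum.If_cases Int_def)
  also have "\<dots> \<le> (\<Sum>e\<in>H. real k ^ card V * (1 / real k) ^ (card e - 1))"
  proof (rule sum_mono)
    fix e assume e: "e \<in> H"
    hence eV: "e \<subseteq> V" and "e \<noteq> {}" using H by auto
    hence ce: "card e \<ge> 1" "card e \<le> card V"
      using V by (auto simp: Suc_le_eq card_gt_0_iff finite_subset intro: card_mono)
    have "real (card {f\<in>F. mono f e}) \<le> real (k * k ^ (card V - card e))"
      unfolding F_def mono_def using card_PiE_constant_on[OF V eV] of_nat_le_iff by blast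
    also have "k * k ^ (card V - card e) = k ^ (card V - (card e - 1))"
      using ce by (simp add: Suc_diff_le flip: power_Suc)
    also have "real \<dots> = real k ^ (card V - (card e - 1))"
      by simp
    also have "\<dots> = real k ^ card V * (1 / real k) ^ (card e - 1)"
      using ce k by (subst power_diff) (auto simp: power_one_over)
    finally show "real (card {f\<in>F. mono f e}) \<le> real k ^ card V * (1 / real k) ^ (card e - 1)" .
  qed
  also have "\<dots> = (\<Sum>f\<in>F. X)"
    by (simp add: X_def sum_distrib_left cardF)
  finally have "(\<Sum>f\<in>F. real (card {e\<in>H. mono f e})) \<le> (\<Sum>f\<in>F. X)" .
  moreover have "F \<noteq> {}" using cardF k by (metis card.empty power_eq_0_iff not_one_le_zero)
  \<comment> \<open>Some colouring does no worse than the average \<open>X\<close>; otherwise the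
    strict inequalities would add up to a contradiction.\<close>
  ultimately obtain f where f: "f \<in> F" "real (card {e\<in>H. mono f e}) \<le> X"
    using sum_strict_mono[OF finF, of "\<lambda>_. X" "\<lambda>f. real (card {e\<in>H. mono f e})"]
    by (meson linorder_not_le)
  define Hj where "Hj j = {e\<in>H. \<forall>x\<in>e. f x = j}" for j
  define Vj where "Vj j = {x\<in>V. f x = j}" for j
  define pick where "pick e = (SOME x. x \<in> e)" for e :: "'a set"
  have pick: "pick e \<in> e" if "e \<in> H" for e
    unfolding pick_def using that H by (metis some_in_eq)
  have finHj: "finite (Hj j)" for j using finH by (simp add: Hj_def)
  have part: "real (card (Vj j)) \<le> M + real (card (Hj j))" for j
  proof -
    have "real (card (Vj j - pick ` Hj j)) \<le> M"
    proof (rule M)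
      show "\<forall>e\<in>H. \<not> e \<subseteq> Vj j - pick ` Hj j"
      proof (intro ballI notI)
        fix e assume e: "e \<in> H" "e \<subseteq> Vj j - pick ` Hj j"
        hence "e \<in> Hj j" by (auto simp: Hj_def Vj_def)
        with e pick show False by blast
      qed
    qed (auto simp: Vj_def)
    moreover have "card (Vj j) \<le> card (Vj j - pick ` Hj j) + card (pick ` Hj j)"
      using diff_card_le_card_Diff[of "pick ` Hj j" "Vj j"] finHj by simp
    moreover have "card (pick ` Hj j) \<le> card (Hj j)"
      by (rule card_image_le[OF finHj])
    ultimately show ?thesis by linarith
  qed
  have "V = (\<Union>j<k. Vj j)" using f(1) by (auto simp: Vj_def F_def PiE_iff)
  hence "card V \<le> (\<Sum>j<k. card (Vj j))"
    using card_UN_le[of "{..<k}" Vj] by simp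
  hence "real (card V) \<le> (\<Sum>j<k. real (card (Vj j)))"
    by (metis of_nat_le_iff of_nat_sum)
  also have "\<dots> \<le> (\<Sum>j<k. M + real (card (Hj j)))"
    by (intro sum_mono part)
  also have "\<dots> = real k * M + real (\<Sum>j<k. card (Hj j))"
    by (simp add: sum.distrib)
  \<comment> \<open>Members of \<open>H\<close> are nonempty, so none is constant with two different
    values.\<close>
  also have "(\<Sum>j<k. card (Hj j)) = card (\<Union>j<k. Hj j)"
  proof (rule card_UN_disjoint[symmetric])
    show "\<forall>i\<in>{..<k}. \<forall>j\<in>{..<k}. i \<noteq> j \<longrightarrow> Hj i \<inter> Hj j = {}"
      using pick by (fastforce simp: Hj_def)
  qed (auto simp: finHj)
  also have "card (\<Union>j<k. Hj j) \<le> card {e\<in>H. mono f e}"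
    using finH by (intro card_mono) (auto simp: Hj_def mono_def)
  finally show ?thesis using f(2) by (simp add: X_def)
qed

text \<open>The number \<open>k\<close> of random colours is taken as the integer part of
  \<open>n / (2 * M)\<close>, with \<open>n = card V\<close>. Then \<open>k * M\<close> takes up at
  most half of \<open>n\<close>, and rounding down costs at most a factor 2, so \<open>1 / k\<close>
  is at most \<open>4 * M / n\<close>.\<close>

lemma half_card_le_of_transversals:
  fixes M :: real
  assumes V: "finite V" and H: "H \<subseteq> Pow V" "{} \<notin> H" and M1: "M \<ge> 1" and n: "real (card V) \<ge> 2 * M"
    and M: "\<And>S. S \<subseteq> V \<Longrightarrow> (\<forall>e\<in>H. \<not> e \<subseteq> S) \<Longrightarrow> real (card S) \<le> M"
  shows "real (card V) / 2 \<le> (\<Sum>e\<in>H. (4 * M / real (card V)) ^ (card e - 1))"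
proof -
  define n where "n = real (card V)"
  define k where "k = nat \<lfloor>n / (2 * M)\<rfloor>"
  have r: "n / (2 * M) \<ge> 1" using n M1 by (simp add: n_def)
  have k: "k \<ge> 1" "real k \<le> n / (2 * M)" "real k \<ge> n / (4 * M)"
  proof -
    show "k \<ge> 1" using r unfolding k_def by linarith
    show "real k \<le> n / (2 * M)" using r unfolding k_def by linarith
    have "real k > n / (2 * M) - 1" using r unfolding k_def by linarith
    moreover have "n / (4 * M) = (n / (2 * M)) / 2" by simp
    ultimately show "real k \<ge> n / (4 * M)" using r \<open>k \<ge> 1\<close> by linarith
  qed
  have "n \<le> real k * M + (\<Sum>e\<in>H. (1 / real k) ^ (card e - 1))"
    unfolding n_def by (rule card_le_of_transversals[OF V H k(1) M])
  moreover have "real k * M \<le> n / 2"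
    using mult_right_mono[OF k(2), of M] M1 by simp
  moreover have "(\<Sum>e\<in>H. (1 / real k) ^ (card e - 1)) \<le> (\<Sum>e\<in>H. (4 * M / n) ^ (card e - 1))"
  proof (intro sum_mono power_mono)
    have "0 < n" using n M1 by (simp add: n_def)
    thus "1 / real k \<le> 4 * M / n" using k M1 by (simp add: field_simps)
  qed simp
  ultimately show ?thesis unfolding n_def by linarith
qed

subsection \<open>Triangle-free colourings of cliques\<close>

lemma cliqueD: "clique Q E \<Longrightarrow> v \<in> Q \<Longrightarrow> w \<in> Q \<Longrightarrow> v \<noteq> w \<Longrightarrow> {v, w} \<in> E"
  by (auto simp: clique_def)

lemma clique_subset: "clique Q E \<Longrightarrow> P \<subseteq> Q \<Longrightarrow> clique P E"
  by (auto simp: clique_def)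

text \<open>Ramsey numbers are defined through colourings of \<open>{..<m}\<close>; this carries the
  triangles found there over to an arbitrary vertex set.\<close>

lemma mono_triangle_image:
  assumes f: "inj_on f A" and E: "E \<subseteq> nsets A 2"
    and mt: "mono_triangle E (\<lambda>e. c (f ` e))" and F: "\<And>e. e \<in> E \<Longrightarrow> f ` e \<in> F"
  shows "mono_triangle F c"
proof -
  obtain x y z where xyz: "distinct [x, y, z]" "{x, y} \<in> E" "{y, z} \<in> E" "{x, z} \<in> E"
      "c (f ` {x, y}) = c (f ` {y, z})" "c (f ` {y, z}) = c (f ` {x, z})"
    using mt unfolding mono_triangle_def by blast
  have "x \<in> A" "y \<in> A" "z \<in> A" using xyz E by auto
  hence "distinct [f x, f y, f z]" using xyz(1) f by (auto dest: inj_onD)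
  moreover have "{f x, f y} \<in> F" "{f y, f z} \<in> F" "{f x, f z} \<in> F"
    using F[OF xyz(2)] F[OF xyz(3)] F[OF xyz(4)] by auto
  ultimately show ?thesis
    unfolding mono_triangle_def using xyz(5,6) by (intro exI[of _ "f x"] exI[of _ "f y"] exI[of _ "f z"]) simp
qed

lemma mono_triangle_recolor:
  assumes "inj_on h (c ` E)" and "mono_triangle E (\<lambda>e. h (c e))"
  shows "mono_triangle E c"
proof -
  obtain x y z where xyz: "distinct [x, y, z]" "{x, y} \<in> E" "{y, z} \<in> E" "{x, z} \<in> E"
      "h (c {x, y}) = h (c {y, z})" "h (c {y, z}) = h (c {x, z})"
    using assms(2) unfolding mono_triangle_def by blast
  have "c {x, y} = c {y, z}" "c {y, z} = c {x, z}"
    by (rule inj_onD[OF assms(1)]; use xyz in blast)+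
  thus ?thesis unfolding mono_triangle_def using xyz(1-4) by blast
qed

text \<open>Only the number of colours matters: relabelling them injectively creates no
  monochromatic triangle. This allows colours to be deleted from the middle of
  \<open>{..<t}\<close>.\<close>

lemma K3_free_colorableI:
  assumes c: "c \<in> E \<rightarrow> C" and C: "finite C" "card C \<le> t" and "\<not> mono_triangle E c"
  shows "K3_free_colorable t E"
proof -
  obtain h where h: "h ` C \<subseteq> {..<t}" "inj_on h C"
    using card_le_inj[OF C(1), of "{..<t}"] C(2) by auto
  have "inj_on h (c ` E)" using h(2) c by (auto intro: inj_on_subset)
  hence "\<not> mono_triangle E (\<lambda>e. h (c e))" using mono_triangle_recolor assms(4) by blast
  moreover have "(\<lambda>e. h (c e)) \<in> E \<rightarrow> {..<t}" using h(1) c by blast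
  ultimately show ?thesis unfolding K3_free_colorable_def by blast
qed

lemma card_clique_less_ramsey3:
  assumes "K3_free_colorable t E" "clique Q E" "finite Q"
  shows "card Q < ramsey3 t"
proof (rule ccontr)
  assume "\<not> card Q < ramsey3 t"
  then obtain f where f: "f ` {..<ramsey3 t} \<subseteq> Q" "inj_on f {..<ramsey3 t}"
    using card_le_inj[of "{..<ramsey3 t}" Q] assms(3) by auto
  have im: "f ` e \<in> E" if "e \<in> nsets {..<ramsey3 t} 2" for e
  proof -
    from that obtain x y where "e = {x, y}" "x < ramsey3 t" "y < ramsey3 t" "x \<noteq> y"
      by (auto simp: nsets_2_eq)
    thus ?thesis using f assms(2) by (auto intro!: cliqueD[OF assms(2)] dest: inj_onD)
  qed
  obtain c where c: "c \<in> E \<rightarrow> {..<t}" "\<not> mono_triangle E c"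
    using assms(1) unfolding K3_free_colorable_def by blast
  have "(\<lambda>e. c (f ` e)) \<in> nsets {..<ramsey3 t} 2 \<rightarrow> {..<t}"
    using im c(1) by blast
  from ramsey3_works[OF this] have "mono_triangle E c"
    by (rule mono_triangle_image[OF f(2) subset_refl _ im])
  thus False using c(2) by blast
qed

lemma clique_free_of_ramsey3_le:
  assumes "K3_free_colorable t E" "ramsey3 t \<le> s" "s > 0"
  shows "clique_free s S E"
  unfolding clique_free_def
proof
  assume "\<exists>K\<in>nsets S s. clique K E"
  then obtain K where "K \<in> nsets S s" "clique K E" by blast
  thus False using card_clique_less_ramsey3[OF assms(1), of K] assms(2) by (auto simp: nsets_def)
qed

section \<open>Colours seen from a vertex of a clique\<close>

definition seen :: "('a set \<Rightarrow> nat) \<Rightarrow> 'a \<Rightarrow> 'a set \<Rightarrow> nat set" where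
  "seen c v Q = (\<lambda>q. c {v, q}) ` Q"

lemma local_coloring_imp_mono_triangle:
  assumes c: "local_coloring k Q c" "finite Q" "card Q \<ge> local_ramsey3 k"
  shows "mono_triangle (nsets Q 2) c"
proof -
  let ?R = "{..<local_ramsey3 k}"
  obtain f where f: "f ` ?R \<subseteq> Q" "inj_on f ?R"
    using card_le_inj[of ?R Q] c by auto
  have im: "f ` e \<in> nsets Q 2" if "e \<in> nsets ?R 2" for e
    using that f by (auto simp: nsets_def card_image inj_on_subset)
  have "local_coloring k ?R (\<lambda>e. c (f ` e))"
    unfolding local_coloring_def
  proof
    fix v assume v: "v \<in> ?R"
    have "(\<lambda>e. c (f ` e)) ` {e \<in> nsets ?R 2. v \<in> e} \<subseteq> c ` {e \<in> nsets Q 2. f v \<in> e}"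
      using im by auto
    hence "card ((\<lambda>e. c (f ` e)) ` {e \<in> nsets ?R 2. v \<in> e}) \<le> card (c ` {e \<in> nsets Q 2. f v \<in> e})"
      using c(2) by (intro card_mono) (auto simp: finite_imp_finite_nsets)
    also have "\<dots> \<le> k" using c(1) f(1) v unfolding local_coloring_def by blast
    finally show "card ((\<lambda>e. c (f ` e)) ` {e \<in> nsets ?R 2. v \<in> e}) \<le> k" .
  qed
  from local_ramsey3_works[OF this] show ?thesis
    by (rule mono_triangle_image[OF f(2) subset_refl _ im])
qed

text \<open>If every vertex saw at most \<open>k = g_loc (card Q) - 1\<close> colours, the colouring
  of \<open>Q\<close> would be a local \<open>k\<close>-colouring. Minimality of
  \<open>g_loc\<close> says that \<open>card Q\<close> is at least \<open>local_ramsey3 k\<close>,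
  so a monochromatic triangle would appear.\<close>

lemma ex_vertex_sees_g_loc:
  assumes Q: "finite Q" "card Q \<ge> 2" and c: "\<not> mono_triangle (nsets Q 2) c"
  shows "\<exists>v\<in>Q. g_loc (card Q) \<le> card (seen c v (Q - {v}))"
proof (rule ccontr)
  assume neg: "\<not> ?thesis"
  define k where "k = g_loc (card Q) - 1"
  have pos: "g_loc (card Q) > 0" using Q by (intro g_loc_pos)
  have "local_coloring k Q c"
    unfolding local_coloring_def
  proof
    fix v assume v: "v \<in> Q"
    have "c ` {e \<in> nsets Q 2. v \<in> e} = seen c v (Q - {v})"
      using v by (force simp: seen_def nsets_2_eq insert_commute)
    thus "card (c ` {e \<in> nsets Q 2. v \<in> e}) \<le> k"
      using neg v pos unfolding k_def by fastforce
  qed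
  moreover have "card Q \<ge> local_ramsey3 k"
    using not_less_Least[of k "\<lambda>k. local_ramsey3 k > card Q"] pos
    by (simp add: k_def g_loc_def)
  ultimately show False
    using local_coloring_imp_mono_triangle Q c by blast
qed

subsection \<open>Building cliques vertex by vertex\<close>

locale triangle_free_coloring =
  fixes V :: "'a set" and E :: "'a set set" and c :: "'a set \<Rightarrow> nat" and t :: nat
  assumes finite_V: "finite V" and E_subset: "E \<subseteq> nsets V 2"
    and c_less: "e \<in> E \<Longrightarrow> c e < t" and no_mono: "\<not> mono_triangle E c"
begin

lemma edgeD: "{x, y} \<in> E \<Longrightarrow> x \<in> V \<and> y \<in> V \<and> x \<noteq> y"
  using E_subset doubleton_in_nsets_2[of x y V] by blast

lemma no_mono_triangle:
  assumes "{x, y} \<in> E" "{y, z} \<in> E" "{x, z} \<in> E" "c {x, y} = a" "c {y, z} = a"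
  shows "c {x, z} \<noteq> a"
proof
  assume "c {x, z} = a"
  moreover have "distinct [x, y, z]" using edgeD[OF assms(1)] edgeD[OF assms(2)] edgeD[OF assms(3)] by auto
  ultimately have "mono_triangle E c"
    unfolding mono_triangle_def using assms by (intro exI[of _ x] exI[of _ y] exI[of _ z]) simp
  with no_mono show False ..
qed

text \<open>This isolates what the counting of cliques needs: a bound \<open>B\<close> on all vertex
  sets whose inner edges miss at least \<open>k\<close> colours. The value of \<open>B\<close> is
  supplied later, either by \<open>M\<close> itself or by the induction hypothesis.\<close>

definition avoid_bound :: "nat \<Rightarrow> real \<Rightarrow> bool" where
  "avoid_bound k B \<longleftrightarrow> B \<ge> 0 \<and> (\<forall>N A. N \<subseteq> V \<longrightarrow> A \<subseteq> {..<t} \<longrightarrow> card A \<ge> k \<longrightarrow>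
     (\<forall>x\<in>N. \<forall>y\<in>N. {x, y} \<in> E \<longrightarrow> c {x, y} \<notin> A) \<longrightarrow> real (card N) \<le> B)"

lemma avoid_boundD:
  assumes "avoid_bound k B" "N \<subseteq> V" "A \<subseteq> {..<t}" "card A \<ge> k"
    and "\<And>x y. x \<in> N \<Longrightarrow> y \<in> N \<Longrightarrow> {x, y} \<in> E \<Longrightarrow> c {x, y} \<notin> A"
  shows "real (card N) \<le> B"
proof -
  have "\<forall>x\<in>N. \<forall>y\<in>N. {x, y} \<in> E \<longrightarrow> c {x, y} \<notin> A" using assms(5) by simp
  with assms(1-4) show ?thesis unfolding avoid_bound_def by simp
qed

definition extends :: "'a set \<Rightarrow> 'a \<Rightarrow> bool" where
  "extends Q v \<longleftrightarrow> v \<in> V \<and> v \<notin> Q \<and> (\<forall>q\<in>Q. {v, q} \<in> E)"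

text \<open>The extending vertices are sorted by their pattern \<open>p\<close> of colours towards
  \<open>Q\<close>, with at most \<open>t ^ card Q\<close> patterns. An edge between two vertices of
  one class cannot have a colour \<open>p q\<close>, since it would close a monochromatic triangle
  with \<open>q\<close>. So each class misses at least \<open>k\<close> colours.\<close>

lemma card_extensions_le:
  assumes B: "avoid_bound k B" and Q: "finite Q"
  shows "real (card {v. extends Q v \<and> k \<le> card (seen c v Q)}) \<le> real t ^ card Q * B"
proof -
  define Ext where "Ext = {v. extends Q v \<and> k \<le> card (seen c v Q)}"
  define P where "P = Q \<rightarrow>\<^sub>E {..<t}"
  define N where "N p = {v \<in> Ext. restrict (\<lambda>q. c {v, q}) Q = p}" for p
  have B0: "B \<ge> 0" using B by (simp add: avoid_bound_def)
  have finP: "finite P" using Q unfolding P_def by (intro finite_PiE) auto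
  \<comment> \<open>A member of \<open>N p\<close> is what shows that \<open>p\<close> takes at
    least \<open>k\<close> values, all below \<open>t\<close>. Empty classes are covered by
    \<open>B \<ge> 0\<close>.\<close>
  have cardN: "real (card (N p)) \<le> B" if ne: "N p \<noteq> {}" for p
  proof -
    obtain v0 where v0: "v0 \<in> N p" using ne by blast
    have pq: "c {v, q} = p q" if "v \<in> N p" "q \<in> Q" for v q
      using that by (auto simp: N_def)
    have "p ` Q = seen c v0 Q" using pq v0 by (auto simp: seen_def image_iff)
    hence "card (p ` Q) \<ge> k" "p ` Q \<subseteq> {..<t}"
      using v0 by (auto simp: N_def Ext_def extends_def seen_def c_less)
    moreover have "c {x, y} \<notin> p ` Q" if xy: "x \<in> N p" "y \<in> N p" "{x, y} \<in> E" for x y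
    proof
      assume "c {x, y} \<in> p ` Q"
      then obtain q where q: "q \<in> Q" "c {x, y} = p q" by blast
      have "{x, q} \<in> E" "{y, q} \<in> E"
        using xy q by (auto simp: N_def Ext_def extends_def)
      thus False
        using no_mono_triangle[of x y q "p q"] xy q pq by auto
    qed
    moreover have "N p \<subseteq> V" by (auto simp: N_def Ext_def extends_def)
    ultimately show ?thesis
      using avoid_boundD[OF B] by simp
  qed
  have "Ext \<subseteq> (\<Union>p\<in>P. N p)"
    by (auto simp: N_def P_def Ext_def extends_def c_less)
  moreover have finN: "finite (N p)" for p
    using finite_V by (rule rev_finite_subset) (auto simp: N_def Ext_def extends_def)
  ultimately have "card Ext \<le> card (\<Union>p\<in>P. N p)"
    using finP by (intro card_mono) auto
  also have "\<dots> \<le> (\<Sum>p\<in>P. card (N p))"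
    by (rule card_UN_le[OF finP])
  finally have "real (card Ext) \<le> (\<Sum>p\<in>P. real (card (N p)))"
    by (simp only: of_nat_le_iff flip: of_nat_sum)
  also have "\<dots> \<le> (\<Sum>p\<in>P. B)"
    using cardN B0 by (intro sum_mono) (metis card.empty of_nat_0)
  also have "\<dots> = real t ^ card Q * B"
    using Q by (simp add: P_def card_PiE)
  finally show ?thesis by (simp add: Ext_def)
qed

text \<open>\<open>F\<close> is the family of starting sets. The requirement \<open>k\<close> is
  indexed by the size after the new vertex is added, which matches \<open>g_loc (card Q)\<close> for
  the finished clique \<open>Q\<close>.\<close>

inductive_set built :: "'a set set \<Rightarrow> (nat \<Rightarrow> nat) \<Rightarrow> 'a set set" for F k where
  base: "Q \<in> F \<Longrightarrow> Q \<in> built F k"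
| step: "Q \<in> built F k \<Longrightarrow> extends Q v \<Longrightarrow> k (Suc (card Q)) \<le> card (seen c v Q) \<Longrightarrow>
    insert v Q \<in> built F k"

text \<open>The rule \<open>step\<close> read backwards: to show that a clique is built, peel off a
  vertex that sees enough colours on the rest.\<close>

lemma built_remove:
  assumes "clique Q E" "Q \<subseteq> V" "v \<in> Q" "Q - {v} \<in> built F k" "k (card Q) \<le> card (seen c v (Q - {v}))"
  shows "Q \<in> built F k"
proof -
  have "finite Q" using assms(2) finite_V finite_subset by blast
  hence "Suc (card (Q - {v})) = card Q" using assms(3) by (rule card_Suc_Diff1)
  moreover have "extends (Q - {v}) v"
    using assms by (auto simp: extends_def intro: cliqueD)
  ultimately have "insert v (Q - {v}) \<in> built F k"
    using assms by (intro built.step) auto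
  thus ?thesis using assms(3) by (simp add: insert_absorb)
qed

lemma built_subset:
  assumes "F \<subseteq> Pow V" "Q \<in> built F k"
  shows "Q \<subseteq> V"
  using assms(2) by induction (use assms(1) in \<open>auto simp: extends_def\<close>)

lemma built_card_ge:
  assumes "F \<subseteq> nsets V b" "Q \<in> built F k"
  shows "finite Q \<and> card Q \<ge> b \<and> (card Q = b \<longrightarrow> Q \<in> F)"
  using assms(2)
proof induction
  case (base Q)
  thus ?case using assms(1) by (auto simp: nsets_def)
next
  case (step Q v)
  thus ?case by (auto simp: extends_def)
qed

text \<open>Each built set of size \<open>i > b\<close> comes from one of size \<open>i - 1\<close>
  by adding a vertex, and \<open>card_extensions_le\<close> leaves at most
  \<open>t ^ (i - 1) * B i\<close> choices for it.\<close>

lemma card_built_le: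
  assumes F: "F \<subseteq> nsets V b" and B: "\<And>i. i \<in> {b<..r} \<Longrightarrow> avoid_bound (k i) (B i)"
    and "b \<le> r"
  shows "real (card {Q \<in> built F k. card Q = r}) \<le>
    real (card F) * (\<Prod>i\<in>{b<..r}. real t ^ (i - 1) * B i)"
  using assms(3) B
proof (induction r rule: dec_induct)
  case base
  have "{Q \<in> built F k. card Q = b} \<subseteq> F" using built_card_ge[OF F] by blast
  hence "card {Q \<in> built F k. card Q = b} \<le> card F"
    by (rule card_mono[OF finite_subset[OF F finite_imp_finite_nsets[OF finite_V]]])
  thus ?case by simp
next
  case (step r)
  let ?A = "{Q \<in> built F k. card Q = r}"
  let ?X = "\<lambda>Q. {v. extends Q v \<and> k (Suc r) \<le> card (seen c v Q)}"
  have FV: "F \<subseteq> Pow V" using F by (auto simp: nsets_def)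
  have finA: "finite ?A"
    by (rule finite_subset[of _ "Pow V"]) (use finite_V built_subset[OF FV] in auto)
  have finX: "finite (?X Q)" for Q
    using finite_V by (rule rev_finite_subset) (auto simp: extends_def)
  have "{Q \<in> built F k. card Q = Suc r} \<subseteq> (\<Union>Q\<in>?A. (\<lambda>v. insert v Q) ` ?X Q)"
  proof
    fix Q assume "Q \<in> {Q \<in> built F k. card Q = Suc r}"
    hence Q: "Q \<in> built F k" "card Q = Suc r" by auto
    from Q(1) show "Q \<in> (\<Union>Q\<in>?A. (\<lambda>v. insert v Q) ` ?X Q)"
    proof cases
      case base
      thus ?thesis using F Q(2) step.hyps by (auto simp: nsets_def)
    next
      case (step Q' v)
      hence "finite Q'" using built_card_ge[OF F] by blast
      hence "card Q' = r" using step Q(2) by (simp add: extends_def)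
      thus ?thesis using step by auto
    qed
  qed
  hence "card {Q \<in> built F k. card Q = Suc r} \<le> card (\<Union>Q\<in>?A. (\<lambda>v. insert v Q) ` ?X Q)"
    using finA finX by (intro card_mono) auto
  also have "\<dots> \<le> (\<Sum>Q\<in>?A. card ((\<lambda>v. insert v Q) ` ?X Q))"
    by (rule card_UN_le[OF finA])
  also have "\<dots> \<le> (\<Sum>Q\<in>?A. card (?X Q))"
    by (intro sum_mono card_image_le finX)
  finally have "real (card {Q \<in> built F k. card Q = Suc r}) \<le> (\<Sum>Q\<in>?A. real (card (?X Q)))"
    by (simp only: of_nat_le_iff flip: of_nat_sum)
  also have "\<dots> \<le> (\<Sum>Q\<in>?A. real t ^ r * B (Suc r))"
  proof (rule sum_mono)
    fix Q assume Q: "Q \<in> ?A"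
    hence "finite Q" using built_card_ge[OF F] by blast
    thus "real (card (?X Q)) \<le> real t ^ r * B (Suc r)"
      using card_extensions_le[OF step.prems, of "Suc r" Q] Q step.hyps by simp
  qed
  also have "\<dots> = real (card ?A) * (real t ^ r * B (Suc r))" by simp
  also have "\<dots> \<le> (real (card F) * (\<Prod>i\<in>{b<..r}. real t ^ (i - 1) * B i)) * (real t ^ r * B (Suc r))"
    using step.IH step.prems[of "Suc r"] step.prems step.hyps
    by (intro mult_right_mono) (auto simp: avoid_bound_def)
  also have "{b<..Suc r} = insert (Suc r) {b<..r}" using step.hyps by auto
  hence "(real (card F) * (\<Prod>i\<in>{b<..r}. real t ^ (i - 1) * B i)) * (real t ^ r * B (Suc r)) =
    real (card F) * (\<Prod>i\<in>{b<..Suc r}. real t ^ (i - 1) * B i)" by (simp add: mult_ac)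
  finally show ?case .
qed

lemma colorable: "K3_free_colorable t E"
  using c_less no_mono unfolding K3_free_colorable_def by blast

lemma colorable_avoiding:
  assumes "A \<subseteq> {..<t}" "card A \<ge> k" "\<And>x y. x \<in> N \<Longrightarrow> y \<in> N \<Longrightarrow> {x, y} \<in> E \<Longrightarrow> c {x, y} \<notin> A"
  shows "K3_free_colorable (t - k) (E \<inter> nsets N 2)"
proof (rule K3_free_colorableI)
  show "c \<in> E \<inter> nsets N 2 \<rightarrow> {..<t} - A"
    using assms(3) c_less by (auto simp: nsets_2_eq)
  have "finite A" using assms(1) finite_subset by blast
  thus "card ({..<t} - A) \<le> t - k"
    using assms(1,2) by (simp add: card_Diff_subset)
  show "\<not> mono_triangle (E \<inter> nsets N 2) c"
    using no_mono mono_triangle_mono by blast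
qed simp

section \<open>Cliques built by adding vertices that see two colours\<close>

lemma card_seen_ge_2:
  assumes "finite Q" "x \<in> Q" "y \<in> Q" "c {v, x} \<noteq> c {v, y}"
  shows "2 \<le> card (seen c v Q)"
proof -
  have "card {c {v, x}, c {v, y}} \<le> card (seen c v Q)"
    using assms by (intro card_mono) (auto simp: seen_def)
  thus ?thesis using assms(4) by simp
qed

lemma seen_eqD:
  assumes "finite Q" "x \<in> Q" "y \<in> Q" "card (seen c v Q) < 2"
  shows "c {v, x} = c {v, y}"
  using card_seen_ge_2[OF assms(1-3)] assms(4) by (meson leD)

text \<open>In a triangle \<open>x, y, z\<close> of \<open>Q\<close>, if \<open>x\<close> sees the
  same colour on \<open>y\<close> and \<open>z\<close>, then \<open>y\<close> must see two colours,
  as the triangle is not monochromatic.\<close>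

lemma ex_vertex_sees_2:
  assumes Q: "clique Q E" "finite Q" "card Q \<ge> 3"
  shows "\<exists>v\<in>Q. 2 \<le> card (seen c v (Q - {v}))"
proof -
  obtain R where "R \<subseteq> Q" "card R = 3" using obtain_subset_with_card_n[OF Q(3)] by metis
  then obtain x y z where xyz: "x \<in> Q" "y \<in> Q" "z \<in> Q" "x \<noteq> y" "y \<noteq> z" "x \<noteq> z"
    by (auto simp: card_3_iff)
  show ?thesis
  proof (cases "c {x, y} = c {x, z}")
    case False
    thus ?thesis using xyz Q(2) by (intro bexI[of _ x] card_seen_ge_2[of _ y z]) auto
  next
    case True
    have E: "{x, y} \<in> E" "{y, z} \<in> E" "{x, z} \<in> E"
      using xyz by (auto intro: cliqueD[OF Q(1)])
    have "c {y, x} \<noteq> c {y, z}"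
    proof
      assume "c {y, x} = c {y, z}"
      thus False using no_mono_triangle[OF E] True by (metis insert_commute)
    qed
    thus ?thesis using xyz Q(2) by (intro bexI[of _ y] card_seen_ge_2[of _ x z]) auto
  qed
qed

text \<open>Vertices seeing two colours are peeled off until a single edge is left. The predicate
  \<open>P\<close> restricts the colours in \<open>Q\<close>: it is trivial for arbitrary cliques,
  and \<open>b \<noteq> a\<close> for cliques without colour \<open>a\<close>.\<close>

lemma built_of_edges:
  assumes F: "\<And>x y. x \<in> W \<Longrightarrow> y \<in> W \<Longrightarrow> {x, y} \<in> E \<Longrightarrow> P (c {x, y}) \<Longrightarrow> {x, y} \<in> F"
    and W: "W \<subseteq> V"
  shows "clique Q E \<Longrightarrow> Q \<subseteq> W \<Longrightarrow> card Q \<ge> 2 \<Longrightarrow>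
    (\<And>x y. x \<in> Q \<Longrightarrow> y \<in> Q \<Longrightarrow> x \<noteq> y \<Longrightarrow> P (c {x, y})) \<Longrightarrow> Q \<in> built F (\<lambda>_. 2)"
proof (induction "card Q" arbitrary: Q)
  case 0
  thus ?case by simp
next
  case (Suc n)
  have fin: "finite Q" using finite_subset[OF Suc.prems(2) finite_subset[OF W finite_V]] .
  show ?case
  proof (cases "card Q = 2")
    case True
    then obtain x y where Q: "Q = {x, y}" "x \<noteq> y" by (auto simp: card_2_iff)
    have "{x, y} \<in> E" using Q by (intro cliqueD[OF Suc.prems(1)]) auto
    hence "Q \<in> F" using Q Suc.prems(2,4) by (auto intro!: F)
    thus ?thesis by (rule built.base)
  next
    case False
    hence "card Q \<ge> 3" using Suc.prems(3) by simp
    then obtain v where v: "v \<in> Q" "2 \<le> card (seen c v (Q - {v}))"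
      using ex_vertex_sees_2[OF Suc.prems(1) fin] by blast
    have "Q - {v} \<in> built F (\<lambda>_. 2)"
    proof (rule Suc.hyps)
      show "n = card (Q - {v})" "2 \<le> card (Q - {v})"
        using Suc.hyps(2) v(1) fin \<open>card Q \<ge> 3\<close> by simp_all
      show "clique (Q - {v}) E" by (rule clique_subset[OF Suc.prems(1)]) simp
    qed (use Suc.prems in auto)
    thus ?thesis
      by (rule built_remove[where v = v, rotated 3]) (use Suc.prems(1,2) v W in auto)
  qed
qed

section \<open>Cliques built from an edge whose colour is not \<open>a\<close>\<close>

context
  fixes a :: nat and W :: "'a set" and F :: "'a set set"
  assumes F: "\<And>x y. x \<in> W \<Longrightarrow> y \<in> W \<Longrightarrow> {x, y} \<in> E \<Longrightarrow> c {x, y} \<noteq> a \<Longrightarrow> {x, y} \<in> F"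
    and W: "W \<subseteq> V"
begin

text \<open>Any \<open>v\<close> other than \<open>u\<close> can be peeled off while a third vertex
  \<open>w\<close> remains: \<open>v\<close> sees \<open>b\<close> on \<open>u\<close> but not on
  \<open>w\<close>, since \<open>u, v, w\<close> would otherwise be monochromatic. The last edge
  contains \<open>u\<close> and has colour \<open>b \<noteq> a\<close>.\<close>

lemma built_uniform_vertex:
  "clique Q E \<Longrightarrow> Q \<subseteq> W \<Longrightarrow> card Q \<ge> 2 \<Longrightarrow> u \<in> Q \<Longrightarrow> b \<noteq> a \<Longrightarrow>
    (\<And>x. x \<in> Q \<Longrightarrow> x \<noteq> u \<Longrightarrow> c {u, x} = b) \<Longrightarrow> Q \<in> built F (\<lambda>_. 2)"
proof (induction "card Q" arbitrary: Q)
  case 0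
  thus ?case by simp
next
  case (Suc n)
  have fin: "finite Q" using finite_subset[OF Suc.prems(2) finite_subset[OF W finite_V]] .
  show ?case
  proof (cases "card Q = 2")
    case True
    then obtain x where Q: "Q = {u, x}" "u \<noteq> x" using Suc.prems(4) by (auto simp: card_2_iff)
    have "{u, x} \<in> E" using Q by (intro cliqueD[OF Suc.prems(1)]) auto
    hence "Q \<in> F" using Q Suc.prems by (auto intro!: F)
    thus ?thesis by (rule built.base)
  next
    case False
    hence card: "card Q \<ge> 3" using Suc.prems(3) by simp
    have "card (Q - {u}) \<ge> 2" using card Suc.prems(4) fin by simp
    then obtain R where "R \<subseteq> Q - {u}" "card R = 2" using obtain_subset_with_card_n by metis
    then obtain v w where vw: "v \<in> Q" "w \<in> Q" "v \<noteq> u" "w \<noteq> u" "v \<noteq> w"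
      by (auto simp: card_2_iff)
    have "{u, v} \<in> E" "{v, w} \<in> E" "{u, w} \<in> E"
      using vw Suc.prems(4) by (auto intro: cliqueD[OF Suc.prems(1)])
    hence "c {v, w} \<noteq> b"
      using no_mono_triangle[of u v w b] Suc.prems(6) vw by blast
    moreover have "c {v, u} = b"
      using Suc.prems(6)[of v] vw by (simp add: insert_commute)
    ultimately have "2 \<le> card (seen c v (Q - {v}))"
      using vw fin Suc.prems(4) by (intro card_seen_ge_2[of _ w u]) auto
    moreover have "Q - {v} \<in> built F (\<lambda>_. 2)"
    proof (rule Suc.hyps)
      show "n = card (Q - {v})" "2 \<le> card (Q - {v})"
        using Suc.hyps(2) vw(1) fin card by simp_all
      show "clique (Q - {v}) E" by (rule clique_subset[OF Suc.prems(1)]) simp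
    qed (use Suc.prems vw in auto)
    ultimately show ?thesis
      by (intro built_remove[of Q v]) (use Suc.prems(1,2) vw W in auto)
  qed
qed

text \<open>Vertices outside the triangle are removed while one of them sees two colours; if none does,
  any of them is joined to all of the rest in a single colour, which is not \<open>a\<close>.\<close>

lemma built_triangle:
  assumes "x \<noteq> y" "y \<noteq> z" "x \<noteq> z" "c {x, y} = a" "c {x, z} \<noteq> a" "c {y, z} \<noteq> a"
  shows "clique Q E \<Longrightarrow> Q \<subseteq> W \<Longrightarrow> {x, y, z} \<subseteq> Q \<Longrightarrow> Q \<in> built F (\<lambda>_. 2)"
proof (induction "card Q" arbitrary: Q rule: less_induct)
  case less
  have fin: "finite Q" using finite_subset[OF less.prems(2) finite_subset[OF W finite_V]] .
  have QV: "Q \<subseteq> V" using less.prems(2) W by blast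
  show ?case
  proof (cases "\<exists>v\<in>Q - {x, y, z}. 2 \<le> card (seen c v (Q - {v}))")
    case True
    then obtain v where v: "v \<in> Q" "v \<notin> {x, y, z}" "2 \<le> card (seen c v (Q - {v}))" by blast
    have "Q - {v} \<in> built F (\<lambda>_. 2)"
    proof (rule less.hyps)
      show "card (Q - {v}) < card Q" using v fin by (meson card_Diff1_less)
      show "clique (Q - {v}) E" by (rule clique_subset[OF less.prems(1)]) simp
    qed (use less.prems v in auto)
    thus ?thesis
      by (rule built_remove[where v = v, rotated 3]) (use less.prems(1) QV v in auto)
  next
    case none: False
    show ?thesis
    proof (cases "Q = {x, y, z}")
      case True
      \<comment> \<open>The starting edge is \<open>{x, z}\<close>; the remaining vertex
        \<open>y\<close> sees \<open>a\<close> on \<open>x\<close> and another colour on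
        \<open>z\<close>.\<close>
      have "{x, z} \<in> E" using assms True by (intro cliqueD[OF less.prems(1)]) auto
      hence "{x, z} \<in> F" using assms less.prems(2) True by (intro F) auto
      moreover have "Q - {y} = {x, z}" using True assms by auto
      ultimately have "Q - {y} \<in> built F (\<lambda>_. 2)" by (simp add: built.base)
      moreover have "2 \<le> card (seen c y (Q - {y}))"
        using True assms by (intro card_seen_ge_2[of _ x z]) (auto simp: insert_commute)
      ultimately show ?thesis
        by (intro built_remove[of Q y]) (use less.prems(1,3) QV in auto)
    next
      case False
      then obtain u where u: "u \<in> Q" "u \<noteq> x" "u \<noteq> y" "u \<noteq> z" using less.prems(3) by blast
      hence few: "card (seen c u (Q - {u})) < 2" using none by (auto simp: not_le)
      have eq: "c {u, w} = c {u, x}" if "w \<in> Q" "w \<noteq> u" for w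
        using that u less.prems(3) fin by (intro seen_eqD[OF _ _ _ few]) auto
      have "{u, x} \<in> E" "{x, y} \<in> E" "{u, y} \<in> E"
        using u assms less.prems(3) by (auto intro: cliqueD[OF less.prems(1)])
      \<comment> \<open>The vertex \<open>u\<close> is joined to \<open>x\<close> and
        \<open>y\<close> in one colour; were it \<open>a\<close>, the edge \<open>{x, y}\<close>
        would complete a triangle in colour \<open>a\<close>.\<close>
      hence "c {u, x} \<noteq> a"
        using no_mono_triangle[of u x y a] eq[of y] u(3) less.prems(3) assms(4) by fastforce
      moreover have "2 \<le> card Q"
        using card_mono[of Q "{u, x}"] u less.prems(3) fin by simp
      ultimately show ?thesis
        using built_uniform_vertex[OF less.prems(1,2) _ u(1) _ eq] by simp
    qed
  qed
qed

end

end

section \<open>Clique-freeness under a change of clique size or passage to an induced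
  subgraph\<close>

lemma clique_free_mono:
  assumes "clique_free r S E" "r \<le> s"
  shows "clique_free s S E"
  unfolding clique_free_def
proof
  assume "\<exists>K\<in>nsets S s. clique K E"
  then obtain K where K: "K \<subseteq> S" "finite K" "card K = s" "clique K E" by (auto simp: nsets_def)
  then obtain R where R: "R \<subseteq> K" "card R = r" "finite R"
    using obtain_subset_with_card_n[of r K] assms(2) by metis
  hence "R \<in> nsets S r" "clique R E" using K by (auto simp: nsets_def clique_def)
  thus False using assms(1) by (auto simp: clique_free_def)
qed

lemma clique_free_Int_nsets:
  assumes "clique_free s S (E \<inter> nsets N 2)" "S \<subseteq> N"
  shows "clique_free s S E"
  unfolding clique_free_def
proof
  assume "\<exists>K\<in>nsets S s. clique K E"
  then obtain K where K: "K \<in> nsets S s" "clique K E" by blast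
  hence "clique K (E \<inter> nsets N 2)" using assms(2) by (auto simp: clique_def nsets_def[of S])
  thus False using assms(1) K(1) by (auto simp: clique_free_def)
qed

subsection \<open>Bounds on the number of vertices\<close>

locale bounded_clique_free = triangle_free_coloring +
  fixes s :: nat and M :: real
  assumes s_ge_2: "s \<ge> 2" and M_ge_1: "M \<ge> 1"
    and card_le_M: "S \<subseteq> V \<Longrightarrow> clique_free s S E \<Longrightarrow> real (card S) \<le> M"
begin

text \<open>A set missing \<open>k\<close> colours is coloured with \<open>t - k\<close> colours, so
  it contains no clique of size \<open>s\<close> at all and is itself bounded by
  \<open>M\<close>.\<close>

lemma avoid_bound_ramsey3:
  assumes "ramsey3 (t - k) \<le> s"
  shows "avoid_bound k M"
  unfolding avoid_bound_def
proof (intro conjI allI impI)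
  show "0 \<le> M" using M_ge_1 by simp
  fix N A assume A: "N \<subseteq> V" "A \<subseteq> {..<t}" "k \<le> card A"
    "\<forall>x\<in>N. \<forall>y\<in>N. {x, y} \<in> E \<longrightarrow> c {x, y} \<notin> A"
  hence "K3_free_colorable (t - k) (E \<inter> nsets N 2)"
    by (intro colorable_avoiding[OF A(2,3)]) simp
  hence "clique_free s N (E \<inter> nsets N 2)"
    by (rule clique_free_of_ramsey3_le) (use assms s_ge_2 in auto)
  hence "clique_free s N E"
    by (rule clique_free_Int_nsets) simp
  thus "real (card N) \<le> M"
    by (rule card_le_M[OF A(1)])
qed

text \<open>Sparsification is applied to the \<open>r\<close>-cliques inside \<open>W\<close>: a set
  without them has no \<open>s\<close>-clique either, as \<open>r \<le> s\<close>, and so has size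
  at most \<open>M\<close>. Their number is bounded by \<open>card_built_le\<close>.\<close>

lemma half_card_le_of_built:
  assumes W: "W \<subseteq> V" "real (card W) \<ge> 2 * M" and r: "1 \<le> b" "b \<le> r" "r \<le> s"
    and F: "F \<subseteq> nsets V b" and B: "\<And>i. i \<in> {b<..r} \<Longrightarrow> avoid_bound (k i) (B i)"
    and cl: "\<And>Q. Q \<in> nsets W r \<Longrightarrow> clique Q E \<Longrightarrow> Q \<in> built F k"
  shows "real (card W) / 2 \<le>
    real (card F) * (\<Prod>i\<in>{b<..r}. real t ^ (i - 1) * B i) * (4 * M / real (card W)) ^ (r - 1)"
proof -
  define H where "H = {Q \<in> nsets W r. clique Q E}"
  have finW: "finite W" using W(1) finite_V by (rule finite_subset)
  have "real (card W) / 2 \<le> (\<Sum>Q\<in>H. (4 * M / real (card W)) ^ (card Q - 1))"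
  proof (rule half_card_le_of_transversals[OF finW _ _ M_ge_1 W(2)])
    show "H \<subseteq> Pow W" "{} \<notin> H" using r by (auto simp: H_def nsets_def)
    fix S assume S: "S \<subseteq> W" "\<forall>e\<in>H. \<not> e \<subseteq> S"
    have "clique_free r S E"
      unfolding clique_free_def using S by (auto simp: H_def nsets_def)
    thus "real (card S) \<le> M"
      using S(1) W(1) r(3) by (intro card_le_M) (auto intro: clique_free_mono)
  qed
  also have "\<dots> = (\<Sum>Q\<in>H. (4 * M / real (card W)) ^ (r - 1))"
    by (rule sum.cong) (auto simp: H_def nsets_def)
  also have "\<dots> = real (card H) * (4 * M / real (card W)) ^ (r - 1)"
    by simp
  also have "\<dots> \<le> real (card F) * (\<Prod>i\<in>{b<..r}. real t ^ (i - 1) * B i) * (4 * M / real (card W)) ^ (r - 1)"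
  proof (rule mult_right_mono)
    have FV: "F \<subseteq> Pow V" using F by (auto simp: nsets_def)
    have "finite {Q \<in> built F k. card Q = r}"
      by (rule finite_subset[of _ "Pow V"]) (use finite_V built_subset[OF FV] in auto)
    hence "card H \<le> card {Q \<in> built F k. card Q = r}"
      by (rule card_mono) (auto simp: H_def nsets_def cl)
    hence "real (card H) \<le> real (card {Q \<in> built F k. card Q = r})" by simp
    also have "\<dots> \<le> real (card F) * (\<Prod>i\<in>{b<..r}. real t ^ (i - 1) * B i)"
      by (rule card_built_le[OF F B r(2)])
    finally show "real (card H) \<le> real (card F) * (\<Prod>i\<in>{b<..r}. real t ^ (i - 1) * B i)" .
    show "0 \<le> (4 * M / real (card W)) ^ (r - 1)" using M_ge_1 by simp
  qed
  finally show ?thesis .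
qed

lemma card_pos_of_ge_2M:
  assumes "real n \<ge> 2 * M"
  shows "real n > 0"
  using assms M_ge_1 by linarith

text \<open>Here it suffices to destroy all edges, that is \<open>r = 2\<close>: every neighbourhood
  in a single colour has at most \<open>M\<close> vertices, so there are at most
  \<open>t * M * card V\<close> edges.\<close>

lemma card_le_sqrt_case:
  assumes "t \<ge> 1" and avoid: "avoid_bound 1 M"
  shows "real (card V) \<le> 8 * real t * M ^ 2"
proof (cases "real (card V) \<ge> 2 * M")
  case False
  have "2 * M \<le> 8 * M" using M_ge_1 by simp
  also have "\<dots> \<le> 8 * M ^ 2" using M_ge_1 by (simp add: power2_eq_square)
  also have "\<dots> \<le> 8 * real t * M ^ 2" using assms(1) by (intro mult_right_mono) auto
  finally show ?thesis using False by simp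
next
  case True
  define n where "n = real (card V)"
  have n: "n > 0" using card_pos_of_ge_2M True by (simp add: n_def)
  have "real (card V) / 2 \<le> real (card (nsets V 1)) *
      (\<Prod>i\<in>{1<..2}. real t ^ (i - 1) * M) * (4 * M / real (card V)) ^ (2 - 1)"
  proof (rule half_card_le_of_built[where k = "\<lambda>_. 1"])
    fix Q assume Q: "Q \<in> nsets V 2" "clique Q E"
    then obtain x y where xy: "Q = {x, y}" "x \<noteq> y" "x \<in> V" "y \<in> V" by (auto simp: nsets_2_eq)
    hence "Q - {y} = {x}" by auto
    moreover have "{x} \<in> built (nsets V 1) (\<lambda>_. 1)"
      using xy by (intro built.base) (auto simp: nsets_def)
    moreover have "card (seen c y {x}) = 1" by (simp add: seen_def)
    ultimately show "Q \<in> built (nsets V 1) (\<lambda>_. 1)"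
      using xy Q(2) by (intro built_remove[of Q y]) auto
  qed (use True s_ge_2 avoid in auto)
  moreover have "{Suc 0<..2} = {2}" by auto
  ultimately have "n / 2 \<le> n * (real t * M) * (4 * M / n)"
    by (simp add: n_def)
  also have "\<dots> = 4 * real t * M ^ 2"
    using n by (simp add: power2_eq_square)
  finally show ?thesis by (simp add: n_def)
qed

lemma built_g_loc:
  "clique Q E \<Longrightarrow> Q \<subseteq> V \<Longrightarrow> card Q \<ge> 1 \<Longrightarrow> Q \<in> built (nsets V 1) g_loc"
proof (induction "card Q" arbitrary: Q)
  case 0
  thus ?case by simp
next
  case (Suc n)
  have fin: "finite Q" using finite_subset[OF Suc.prems(2) finite_V] .
  show ?case
  proof (cases "card Q = 1")
    case True
    hence "Q \<in> nsets V 1" using Suc.prems(2) fin by (simp add: nsets_def)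
    thus ?thesis by (rule built.base)
  next
    case False
    hence card: "card Q \<ge> 2" using Suc.prems(3) by simp
    have "nsets Q 2 \<subseteq> E" using Suc.prems(1) by (auto simp: nsets_2_eq intro: cliqueD)
    hence "\<not> mono_triangle (nsets Q 2) c" using no_mono mono_triangle_mono by blast
    from ex_vertex_sees_g_loc[OF fin card this]
    obtain v where v: "v \<in> Q" "g_loc (card Q) \<le> card (seen c v (Q - {v}))" by blast
    have "Q - {v} \<in> built (nsets V 1) g_loc"
    proof (rule Suc.hyps)
      show "n = card (Q - {v})" "1 \<le> card (Q - {v})"
        using Suc.hyps(2) v(1) fin card by simp_all
      show "clique (Q - {v}) E" by (rule clique_subset[OF Suc.prems(1)]) simp
      show "Q - {v} \<subseteq> V" using Suc.prems(2) by blast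
    qed
    thus ?thesis by (rule built_remove[where k = g_loc, OF Suc.prems(1,2) v(1) _ v(2)])
  qed
qed

text \<open>The cliques are built from single vertices. The \<open>card V\<close> possible starts
  cancel against the left-hand side of the sparsification bound, leaving the power
  \<open>s - 1\<close>.\<close>

lemma card_power_le_rec_case:
  assumes avoid: "\<And>i. i \<in> {2..s} \<Longrightarrow> avoid_bound (g_loc i) (B i)" and n: "real (card V) \<ge> 2 * M"
  shows "real (card V) ^ (s - 1) \<le> 2 * (\<Prod>i=2..s. real t ^ (i - 1) * B i) * (4 * M) ^ (s - 1)"
proof -
  define n where "n = real (card V)"
  define P where "P = (\<Prod>i=2..s. real t ^ (i - 1) * B i)"
  have n0: "n > 0" using card_pos_of_ge_2M n by (simp add: n_def)
  have iv: "{Suc 0<..s} = {2..s}" by auto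
  have "real (card V) / 2 \<le> real (card (nsets V 1)) *
      (\<Prod>i\<in>{1<..s}. real t ^ (i - 1) * B i) * (4 * M / real (card V)) ^ (s - 1)"
  proof (rule half_card_le_of_built[where k = g_loc])
    fix Q assume Q: "Q \<in> nsets V s" "clique Q E"
    thus "Q \<in> built (nsets V 1) g_loc"
      using s_ge_2 by (intro built_g_loc) (auto simp: nsets_def)
  qed (use n s_ge_2 avoid in auto)
  hence "n / 2 \<le> n * P * (4 * M / n) ^ (s - 1)"
    by (simp add: n_def P_def iv)
  hence "n ^ (s - 1) \<le> 2 * P * (4 * M) ^ (s - 1)"
    using n0 by (simp add: power_divide field_simps)
  thus ?thesis by (simp add: n_def P_def)
qed

section \<open>Degrees in a colour, and the gain in the fractional case\<close>

definition deg :: "nat \<Rightarrow> 'a \<Rightarrow> nat" where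
  "deg a v = card {u. {v, u} \<in> E \<and> c {v, u} = a}"

lemma finite_nbhd: "finite {u. {v, u} \<in> E \<and> c {v, u} = a}"
  using finite_V by (rule rev_finite_subset) (auto dest: edgeD)

lemma prod_power_const:
  "(\<Prod>i\<in>{2<..r}. real t ^ (i - 1) * M) = (\<Prod>i\<in>{2<..r}. real t ^ (i - 1)) * M ^ (r - 2)"
  by (simp add: prod.distrib)

lemma card_edges_le:
  assumes "finite W" "finite A"
  shows "real (card {{v, u} | v u. v \<in> W \<and> {v, u} \<in> E \<and> c {v, u} \<in> A}) \<le> (\<Sum>a\<in>A. \<Sum>v\<in>W. real (deg a v))"
proof -
  let ?N = "\<lambda>a v. {u. {v, u} \<in> E \<and> c {v, u} = a}"
  have "{{v, u} | v u. v \<in> W \<and> {v, u} \<in> E \<and> c {v, u} \<in> A} \<subseteq> (\<Union>a\<in>A. \<Union>v\<in>W. (\<lambda>u. {v, u}) ` ?N a v)"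
    by blast
  hence "card {{v, u} | v u. v \<in> W \<and> {v, u} \<in> E \<and> c {v, u} \<in> A} \<le> card (\<Union>a\<in>A. \<Union>v\<in>W. (\<lambda>u. {v, u}) ` ?N a v)"
    using assms finite_nbhd by (intro card_mono) auto
  also have "\<dots> \<le> (\<Sum>a\<in>A. card (\<Union>v\<in>W. (\<lambda>u. {v, u}) ` ?N a v))"
    by (rule card_UN_le[OF assms(2)])
  also have "\<dots> \<le> (\<Sum>a\<in>A. \<Sum>v\<in>W. card ((\<lambda>u. {v, u}) ` ?N a v))"
    by (intro sum_mono card_UN_le assms(1))
  also have "\<dots> \<le> (\<Sum>a\<in>A. \<Sum>v\<in>W. deg a v)"
    unfolding deg_def by (intro sum_mono card_image_le finite_nbhd)
  finally show ?thesis by (simp flip: of_nat_sum)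
qed

text \<open>Building starts from an edge. There are at most \<open>t * card W * T\<close> edges
  meeting \<open>W\<close>, and each later vertex sees two colours, hence has at most
  \<open>M\<close> choices per pattern.\<close>

lemma card_power_le_low_degree:
  assumes avoid: "avoid_bound 2 M" and s: "s \<ge> 3" and W: "W \<subseteq> V" "real (card W) \<ge> 2 * M"
    and deg: "\<And>a v. v \<in> W \<Longrightarrow> a < t \<Longrightarrow> real (deg a v) \<le> T"
  shows "real (card W) ^ (s - 1) \<le>
    2 * real t * (\<Prod>i\<in>{2<..s}. real t ^ (i - 1)) * 4 ^ (s - 1) * T * M ^ (2 * s - 3)"
proof -
  define n where "n = real (card W)"
  define P where "P = (\<Prod>i\<in>{2<..s}. real t ^ (i - 1))"
  define F where "F = {{v, u} | v u. v \<in> W \<and> {v, u} \<in> E \<and> c {v, u} \<in> {..<t}}"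
  have finW: "finite W" using W(1) finite_V by (rule finite_subset)
  have n0: "n > 0" using card_pos_of_ge_2M W(2) by (simp add: n_def)
  have P0: "P \<ge> 0" unfolding P_def by (intro prod_nonneg) auto
  have FE: "F \<subseteq> nsets V 2" using E_subset by (auto simp: F_def)
  have "real (card F) \<le> (\<Sum>a<t. \<Sum>v\<in>W. real (deg a v))"
    unfolding F_def by (intro card_edges_le finW) simp
  also have "\<dots> \<le> (\<Sum>a<t. \<Sum>v\<in>W. T)"
    by (intro sum_mono deg) auto
  finally have cF: "real (card F) \<le> real t * n * T" by (simp add: n_def mult_ac)
  have "n / 2 \<le> real (card F) * (\<Prod>i\<in>{2<..s}. real t ^ (i - 1) * M) * (4 * M / n) ^ (s - 1)"
    unfolding n_def
  proof (rule half_card_le_of_built[where k = "\<lambda>_. 2"])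
    fix Q assume "Q \<in> nsets W s" "clique Q E"
    thus "Q \<in> built F (\<lambda>_. 2)"
      using s c_less W(1) by (intro built_of_edges[where P = "\<lambda>_. True" and W = W]) (auto simp: F_def nsets_def)
  qed (use W s avoid FE in auto)
  also have "\<dots> \<le> (real t * n * T) * (P * M ^ (s - 2)) * (4 * M / n) ^ (s - 1)"
    unfolding prod_power_const P_def[symmetric]
    using cF P0 M_ge_1 n0 by (intro mult_right_mono) auto
  finally have "n ^ (s - 1) \<le> 2 * real t * P * 4 ^ (s - 1) * T * (M ^ (s - 2) * M ^ (s - 1))"
    using n0 by (simp add: power_divide power_mult_distrib field_simps)
  moreover have "(s - 2) + (s - 1) = 2 * s - 3" using s by simp
  ultimately show ?thesis unfolding n_def P_def by (metis power_add)
qed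

text \<open>Double counting of the paths \<open>u - v - w\<close> with colours \<open>a\<close>, \<open>b\<close>.\<close>

lemma sum_deg_mult_deg_le:
  assumes avoid: "avoid_bound 2 M" and W: "W \<subseteq> V" and ab: "a \<noteq> b" "a < t" "b < t"
  shows "(\<Sum>v\<in>W. real (deg a v) * real (deg b v)) \<le> real (card V) ^ 2 * M"
proof -
  have finW: "finite W" using W finite_V by (rule finite_subset)
  let ?p = "\<lambda>v x. {v, fst x} \<in> E \<and> c {v, fst x} = a \<and> {v, snd x} \<in> E \<and> c {v, snd x} = b"
  have "(\<Sum>v\<in>W. real (deg a v) * real (deg b v)) = (\<Sum>v\<in>W. \<Sum>x\<in>V \<times> V. if ?p v x then 1 else 0)"
  proof (rule sum.cong[OF refl])
    fix v
    have "{u. {v, u} \<in> E \<and> c {v, u} = a} \<times> {u. {v, u} \<in> E \<and> c {v, u} = b} = {x \<in> V \<times> V. ?p v x}"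
      by (auto dest: edgeD)
    hence "deg a v * deg b v = card {x \<in> V \<times> V. ?p v x}"
      unfolding deg_def by (simp only: flip: card_cartesian_product)
    hence "real (deg a v) * real (deg b v) = real (card {x \<in> V \<times> V. ?p v x})"
      by (simp only: flip: of_nat_mult)
    also have "\<dots> = (\<Sum>x\<in>V \<times> V. if ?p v x then 1 else 0)"
      using finite_V by (simp add: sum.If_cases Int_def)
    finally show "real (deg a v) * real (deg b v) = (\<Sum>x\<in>V \<times> V. if ?p v x then 1 else 0)" .
  qed
  also have "\<dots> = (\<Sum>x\<in>V \<times> V. \<Sum>v\<in>W. if ?p v x then 1 else 0)"
    by (rule sum.swap)
  also have "\<dots> \<le> (\<Sum>x\<in>V \<times> V. M)"
  proof (rule sum_mono)
    fix x
    have "(\<Sum>v\<in>W. if ?p v x then 1 else 0) = real (card {v \<in> W. ?p v x})"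
      using finW by (simp add: sum.If_cases Int_def)
    \<comment> \<open>These \<open>v\<close> are common neighbours of \<open>fst x\<close> in colour
      \<open>a\<close> and of \<open>snd x\<close> in colour \<open>b\<close>; an edge among them in
      either colour would close a monochromatic triangle.\<close>
    also have "\<dots> \<le> M"
    proof (rule avoid_boundD[OF avoid, of _ "{a, b}"])
      fix y z assume yz: "y \<in> {v \<in> W. ?p v x}" "z \<in> {v \<in> W. ?p v x}" "{y, z} \<in> E"
      have "c {y, z} \<noteq> a"
        using no_mono_triangle[of y "fst x" z a] yz by (auto simp: insert_commute)
      moreover have "c {y, z} \<noteq> b"
        using no_mono_triangle[of y "snd x" z b] yz by (auto simp: insert_commute)
      ultimately show "c {y, z} \<notin> {a, b}" by simp
    qed (use W ab in auto)
    finally show "(\<Sum>v\<in>W. if ?p v x then 1 else 0) \<le> M" .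
  qed
  also have "\<dots> = real (card V) ^ 2 * M"
    by (simp add: card_cartesian_product power2_eq_square)
  finally show ?thesis .
qed

text \<open>Every \<open>s\<close>-clique in \<open>W\<close> either has an \<open>m\<close>-subset
  without colour \<open>a\<close>, which lies in \<open>H1\<close>, or lies in \<open>H2\<close>
  itself. So destroying \<open>H1\<close> and \<open>H2\<close> destroys all
  \<open>s\<close>-cliques, and members of both families are built from an edge in
  \<open>F\<close>.\<close>

lemma half_card_le_high_degree:
  assumes avoid: "avoid_bound 2 M" and s: "s \<ge> 3" and m: "m = (s + 1) div 2"
    and W: "W \<subseteq> V" "real (card W) \<ge> 2 * M"
    and F: "F = {{v, u} | v u. v \<in> W \<and> {v, u} \<in> E \<and> c {v, u} \<in> {..<t} - {a}}"
  shows "real (card W) / 2 \<le> real (card F) *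
    ((\<Prod>i\<in>{2<..m}. real t ^ (i - 1)) * M ^ (m - 2) * (4 * M / real (card W)) ^ (m - 1) +
     (\<Prod>i\<in>{2<..s}. real t ^ (i - 1)) * M ^ (s - 2) * (4 * M / real (card W)) ^ (s - 1))"
proof -
  define n where "n = real (card W)"
  define afree where "afree Q \<longleftrightarrow> (\<forall>x\<in>Q. \<forall>y\<in>Q. x \<noteq> y \<longrightarrow> c {x, y} \<noteq> a)" for Q
  define H1 where "H1 = {Q \<in> nsets W m. clique Q E \<and> afree Q}"
  define H2 where "H2 = {Q \<in> nsets W s. clique Q E \<and> \<not> (\<exists>R\<in>nsets Q m. afree R)}"
  have ms: "2 \<le> m" "m \<le> s" "2 * (m - 1) < s" using s unfolding m by linarith+
  have finW: "finite W" using W(1) finite_V by (rule finite_subset)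
  have FE: "F \<subseteq> nsets V 2" using E_subset by (auto simp: F)
  have FI: "{x, y} \<in> F" if "x \<in> W" "y \<in> W" "{x, y} \<in> E" "c {x, y} \<noteq> a" for x y
    using that c_less by (auto simp: F)
  have finH: "finite H1" "finite H2"
    using finW by (auto simp: H1_def H2_def finite_imp_finite_nsets)
  have card_le: "real (card H) \<le> real (card F) * ((\<Prod>i\<in>{2<..r}. real t ^ (i - 1)) * M ^ (r - 2))"
    if H: "H \<subseteq> {Q \<in> built F (\<lambda>_. 2). card Q = r}" "2 \<le> r" for H r
  proof -
    have FV: "F \<subseteq> Pow V" using FE by (auto simp: nsets_def)
    have "finite {Q \<in> built F (\<lambda>_. 2). card Q = r}"
      by (rule finite_subset[of _ "Pow V"]) (use finite_V built_subset[OF FV] in auto)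
    hence "real (card H) \<le> real (card {Q \<in> built F (\<lambda>_. 2). card Q = r})"
      using card_mono[OF _ H(1)] by simp
    also have "\<dots> \<le> real (card F) * (\<Prod>i\<in>{2<..r}. real t ^ (i - 1) * M)"
      by (rule card_built_le[OF FE avoid H(2)])
    finally show ?thesis by (simp only: prod_power_const)
  qed
  have "n / 2 \<le> (\<Sum>Q\<in>H1 \<union> H2. (4 * M / n) ^ (card Q - 1))"
    unfolding n_def
  proof (rule half_card_le_of_transversals[OF finW _ _ M_ge_1 W(2)])
    show "H1 \<union> H2 \<subseteq> Pow W" "{} \<notin> H1 \<union> H2" using ms by (auto simp: H1_def H2_def nsets_def)
    fix S assume S: "S \<subseteq> W" "\<forall>Q\<in>H1 \<union> H2. \<not> Q \<subseteq> S"
    have "clique_free s S E"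
      unfolding clique_free_def
    proof
      assume "\<exists>K\<in>nsets S s. clique K E"
      then obtain K where K: "K \<in> nsets S s" "clique K E" by blast
      hence KW: "K \<in> nsets W s" "K \<subseteq> S" using S(1) by (auto simp: nsets_def)
      have "K \<notin> H2" using S(2) KW by blast
      then obtain R where R: "R \<in> nsets K m" "afree R" using K KW by (auto simp: H2_def)
      hence "R \<subseteq> K" by (auto simp: nsets_def)
      hence "R \<in> H1" using R KW clique_subset[OF K(2)] by (auto simp: H1_def nsets_def)
      thus False using S(2) \<open>R \<subseteq> K\<close> KW by blast
    qed
    thus "real (card S) \<le> M" using S(1) W(1) by (intro card_le_M) auto
  qed
  also have "\<dots> \<le> (\<Sum>Q\<in>H1. (4 * M / n) ^ (card Q - 1)) + (\<Sum>Q\<in>H2. (4 * M / n) ^ (card Q - 1))"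
    using sum.union_inter[OF finH, of "\<lambda>Q. (4 * M / n) ^ (card Q - 1)"]
      sum_nonneg[of "H1 \<inter> H2" "\<lambda>Q. (4 * M / n) ^ (card Q - 1)"] M_ge_1 by (simp add: n_def)
  also have "(\<Sum>Q\<in>H1. (4 * M / n) ^ (card Q - 1)) = real (card H1) * (4 * M / n) ^ (m - 1)"
    by (simp add: H1_def nsets_def)
  also have "(\<Sum>Q\<in>H2. (4 * M / n) ^ (card Q - 1)) = real (card H2) * (4 * M / n) ^ (s - 1)"
    by (simp add: H2_def nsets_def)
  also have "real (card H1) * (4 * M / n) ^ (m - 1) \<le>
      real (card F) * ((\<Prod>i\<in>{2<..m}. real t ^ (i - 1)) * M ^ (m - 2)) * (4 * M / n) ^ (m - 1)"
  proof (intro mult_right_mono card_le)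
    show "H1 \<subseteq> {Q \<in> built F (\<lambda>_. 2). card Q = m}"
    proof
      fix Q assume "Q \<in> H1"
      hence Q: "Q \<subseteq> W" "card Q = m" "clique Q E" "afree Q" by (auto simp: H1_def nsets_def)
      have "Q \<in> built F (\<lambda>_. 2)"
        by (rule built_of_edges[where P = "\<lambda>b. b \<noteq> a", OF FI W(1) Q(3,1)])
          (use Q ms in \<open>auto simp: afree_def\<close>)
      thus "Q \<in> {Q \<in> built F (\<lambda>_. 2). card Q = m}" using Q by simp
    qed
  qed (use ms M_ge_1 in \<open>auto simp: n_def\<close>)
  also have "real (card H2) * (4 * M / n) ^ (s - 1) \<le>
      real (card F) * ((\<Prod>i\<in>{2<..s}. real t ^ (i - 1)) * M ^ (s - 2)) * (4 * M / n) ^ (s - 1)"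
  proof (intro mult_right_mono card_le)
    show "H2 \<subseteq> {Q \<in> built F (\<lambda>_. 2). card Q = s}"
    proof
      fix Q assume "Q \<in> H2"
      hence Q: "Q \<subseteq> W" "card Q = s" "finite Q" "clique Q E"
        and noR: "\<And>R. R \<subseteq> Q \<Longrightarrow> card R = m \<Longrightarrow> finite R \<Longrightarrow> \<not> afree R"
        by (auto simp: H2_def nsets_def)
      have small: "card R < m" if "R \<subseteq> Q" "afree R" for R
      proof (rule ccontr)
        assume "\<not> card R < m"
        then obtain R' where "R' \<subseteq> R" "card R' = m" "finite R'"
          using obtain_subset_with_card_n[of m R] by (metis not_less)
        thus False using noR[of R'] that by (auto simp: afree_def)
      qed
      have "\<not> afree Q" using small[of Q] Q ms by auto
      then obtain x y where xy: "x \<in> Q" "y \<in> Q" "x \<noteq> y" "c {x, y} = a"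
        by (auto simp: afree_def)
      define N where "N v = {w \<in> Q - {v}. c {v, w} = a}" for v
      \<comment> \<open>Two neighbours of \<open>v\<close> in colour \<open>a\<close> cannot be
        joined in colour \<open>a\<close>, so \<open>N v\<close> has fewer than \<open>m\<close>
        vertices. Since \<open>2 * (m - 1) < s\<close>, the sets \<open>N x\<close> and
        \<open>N y\<close> miss some \<open>z\<close>, and \<open>x, y, z\<close> is a triangle
        whose only edge of colour \<open>a\<close> is \<open>{x, y}\<close>.\<close>
      have "afree (N v)" if v: "v \<in> Q" for v
        unfolding afree_def
      proof (intro ballI impI)
        fix w z assume wz: "w \<in> N v" "z \<in> N v" "w \<noteq> z"
        hence "{w, v} \<in> E" "{v, z} \<in> E" "{w, z} \<in> E"
          using v by (auto simp: N_def intro!: cliqueD[OF Q(4)])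
        thus "c {w, z} \<noteq> a"
          using no_mono_triangle[of w v z a] wz by (auto simp: N_def insert_commute)
      qed
      hence "card (N x) < m" "card (N y) < m"
        using small xy by (auto simp: N_def)
      hence "card (N x \<union> N y) < card Q"
        using card_Un_le[of "N x" "N y"] ms Q(2) by linarith
      moreover have "finite (N x \<union> N y)" using Q(3) by (auto simp: N_def)
      ultimately have "\<not> Q \<subseteq> N x \<union> N y" by (meson card_mono leD)
      then obtain z where z: "z \<in> Q" "z \<notin> N x" "z \<notin> N y" by blast
      have "z \<noteq> x" "z \<noteq> y" using z xy by (auto simp: N_def insert_commute)
      hence "Q \<in> built F (\<lambda>_. 2)"
        by (intro built_triangle[where x = x and y = y and z = z, OF FI W(1) xy(3) _ _ xy(4) _ _ Q(4,1)])
          (use xy z in \<open>auto simp: N_def\<close>)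
      thus "Q \<in> {Q \<in> built F (\<lambda>_. 2). card Q = s}" using Q by simp
    qed
  qed (use ms M_ge_1 in \<open>auto simp: n_def\<close>)
  finally show ?thesis by (simp add: n_def algebra_simps)
qed

end

text \<open>The first parenthesis comes from the low-degree estimate, where passing to half of the
  vertices turns its 4 into 8; the second comes from the high-degree estimate. The leading 2 comes
  from the choice of the degree threshold.\<close>

definition frac_const :: "nat \<Rightarrow> nat \<Rightarrow> real" where
  "frac_const s t = (let m = (s + 1) div 2; P = (\<lambda>r. \<Prod>i\<in>{2<..r}. real t ^ (i - 1)) in
     2 * (2 * real t * P s * 8 ^ (s - 1)) * (4 * real t ^ 2 * (P m + P s) * (8 * real t) ^ (m - 1)))"

context bounded_clique_free
begin

text \<open>Degree at least \<open>T\<close> in colour \<open>a\<close> forces few edges in the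
  other colours: \<open>T * card F\<close> is at most the sum of \<open>deg a v * deg b v\<close>,
  which double counting bounds by \<open>t * n ^ 2 * M\<close>. Inserting this into
  \<open>half_card_le_high_degree\<close> gives the claim.\<close>

lemma card_power_le_high_degree:
  assumes avoid: "avoid_bound 2 M" and s: "s \<ge> 3" and m: "m = (s + 1) div 2"
    and t: "t \<ge> 1" and n: "real (card V) \<ge> 8 * real t * M ^ 2" and T: "T > 0" and a: "a < t"
    and W: "W \<subseteq> V" "2 * real t * real (card W) \<ge> real (card V)"
    and deg: "\<And>v. v \<in> W \<Longrightarrow> T \<le> real (deg a v)"
  shows "T * real (card V) ^ (m - 2) \<le> 4 * real t ^ 2 *
    ((\<Prod>i\<in>{2<..m}. real t ^ (i - 1)) + (\<Prod>i\<in>{2<..s}. real t ^ (i - 1))) *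
    (8 * real t) ^ (m - 1) * M ^ (2 * m - 2)"
proof -
  define n where "n = real (card V)"
  define w where "w = real (card W)"
  define P where "P r = (\<Prod>i\<in>{2<..r}. real t ^ (i - 1))" for r
  define q where "q = 4 * M / w"
  define F where "F = {{v, u} | v u. v \<in> W \<and> {v, u} \<in> E \<and> c {v, u} \<in> {..<t} - {a}}"
  have ms: "2 \<le> m" "m \<le> s" using s unfolding m by linarith+
  have P0: "P r \<ge> 0" for r unfolding P_def by (intro prod_nonneg) auto
  have t0: "real t > 0" using t by simp
  have M2: "M \<le> M ^ 2" using M_ge_1 by (simp add: power2_eq_square)
  have "2 * real t * (4 * M ^ 2) \<le> 2 * real t * w" using n W(2) by (simp add: w_def)
  hence w: "4 * M ^ 2 \<le> w" using t0 by simp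
  hence wM: "2 * M \<le> w" using M2 M_ge_1 by linarith
  have w0: "w > 0" using wM M_ge_1 by linarith
  have n0: "n > 0" using n t0 M_ge_1 unfolding n_def by (smt (verit) mult_pos_pos zero_less_power)
  have nw: "n \<le> 2 * real t * w" using W(2) by (simp add: n_def w_def)
  have finW: "finite W" using W(1) finite_V by (rule finite_subset)
  have "T * real (card F) \<le> T * (\<Sum>b\<in>{..<t} - {a}. \<Sum>v\<in>W. real (deg b v))"
    unfolding F_def using T by (intro mult_left_mono card_edges_le finW) auto
  also have "\<dots> = (\<Sum>b\<in>{..<t} - {a}. \<Sum>v\<in>W. T * real (deg b v))"
    by (simp add: sum_distrib_left)
  also have "\<dots> \<le> (\<Sum>b\<in>{..<t} - {a}. \<Sum>v\<in>W. real (deg a v) * real (deg b v))"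
    by (intro sum_mono mult_right_mono deg) auto
  also have "\<dots> \<le> (\<Sum>b\<in>{..<t} - {a}. n ^ 2 * M)"
    unfolding n_def using a by (intro sum_mono sum_deg_mult_deg_le[OF avoid W(1)]) auto
  also have "\<dots> \<le> real t * (n ^ 2 * M)"
    using M_ge_1 card_Diff1_le[of "{..<t}" a] by (auto intro!: mult_right_mono)
  finally have TF: "T * real (card F) \<le> real t * (n ^ 2 * M)" .
  have e: "2 * m - 2 = 1 + (m - 2) + (m - 1)" using ms by simp
  have M2m: "M ^ (2 * m - 2) = M * M ^ (m - 2) * M ^ (m - 1)"
    unfolding e power_add by simp
  have q0: "q \<ge> 0" using M_ge_1 w0 by (simp add: q_def)
  \<comment> \<open>Enlarging a clique from size \<open>m\<close> to \<open>s\<close> costs a factor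
    \<open>M * q\<close> per vertex. As \<open>w \<ge> 4 * M ^ 2\<close>, this is at most 1, so the
    term for \<open>s\<close>-cliques is dominated by the one for \<open>m\<close>-cliques, up to
    the constant \<open>P s\<close>.\<close>
  have "M * q \<le> 1" using w w0 by (simp add: q_def power2_eq_square)
  hence "(M * q) ^ (s - m) \<le> 1" using q0 M_ge_1 by (intro power_le_one) auto
  hence "(P s * M ^ (m - 2) * q ^ (m - 1)) * (M * q) ^ (s - m) \<le> (P s * M ^ (m - 2) * q ^ (m - 1)) * 1"
    using P0 M_ge_1 q0 by (intro mult_left_mono) auto
  moreover have "M ^ (s - 2) = M ^ (m - 2) * M ^ (s - m)" "q ^ (s - 1) = q ^ (m - 1) * q ^ (s - m)"
    using ms by (simp_all flip: power_add)
  ultimately have Ps: "P s * M ^ (s - 2) * q ^ (s - 1) \<le> P s * M ^ (m - 2) * q ^ (m - 1)"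
    by (simp add: power_mult_distrib mult_ac)
  have "q \<le> 8 * real t * M / n"
    using nw w0 n0 M_ge_1 by (simp add: q_def field_simps)
  hence qm: "q ^ (m - 1) \<le> (8 * real t * M / n) ^ (m - 1)" using q0 by (rule power_mono)
  have "n / (4 * real t) \<le> w / 2" using nw t0 by (simp add: field_simps)
  also have "w / 2 \<le> real (card F) * (P m * M ^ (m - 2) * q ^ (m - 1) + P s * M ^ (s - 2) * q ^ (s - 1))"
    unfolding w_def q_def P_def
    by (rule half_card_le_high_degree[OF avoid s m W(1) _ F_def]) (use wM in \<open>simp add: w_def\<close>)
  also have "\<dots> \<le> real (card F) * (P m * M ^ (m - 2) * q ^ (m - 1) + P s * M ^ (m - 2) * q ^ (m - 1))"
    using Ps by (intro mult_left_mono) auto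
  also have "\<dots> = real (card F) * ((P m + P s) * M ^ (m - 2)) * q ^ (m - 1)"
    by (simp add: algebra_simps)
  also have "\<dots> \<le> real (card F) * ((P m + P s) * M ^ (m - 2)) * (8 * real t * M / n) ^ (m - 1)"
    using P0 M_ge_1 by (intro mult_left_mono qm) auto
  finally have "T * (n / (4 * real t)) \<le>
      T * (real (card F) * ((P m + P s) * M ^ (m - 2)) * (8 * real t * M / n) ^ (m - 1))"
    using T by (intro mult_left_mono) auto
  also have "\<dots> = T * real (card F) * (((P m + P s) * M ^ (m - 2)) * (8 * real t * M / n) ^ (m - 1))"
    by (simp add: mult_ac)
  also have "\<dots> \<le> real t * (n ^ 2 * M) * (((P m + P s) * M ^ (m - 2)) * (8 * real t * M / n) ^ (m - 1))"
    using TF P0 M_ge_1 n0 by (intro mult_right_mono) auto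
  finally have "T * (n / (4 * real t)) * n ^ (m - 1) \<le>
      real t * (n ^ 2 * M) * (((P m + P s) * M ^ (m - 2)) * (8 * real t * M / n) ^ (m - 1)) * n ^ (m - 1)"
    using n0 by (intro mult_right_mono) auto
  also have "\<dots> = real t * (n ^ 2 * M) * (((P m + P s) * M ^ (m - 2)) * ((8 * real t) ^ (m - 1) * M ^ (m - 1)))"
    using n0 by (simp add: power_divide power_mult_distrib)
  also have "\<dots> = real t * n ^ 2 * ((P m + P s) * (8 * real t) ^ (m - 1) * M ^ (2 * m - 2))"
    unfolding M2m by (simp add: mult_ac)
  finally have "T * (n / (4 * real t)) * n ^ (m - 1) \<le>
      real t * n ^ 2 * ((P m + P s) * (8 * real t) ^ (m - 1) * M ^ (2 * m - 2))" .
  moreover have "m - 1 = Suc (m - 2)" using ms by simp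
  hence "n ^ (m - 1) = n * n ^ (m - 2)" by (simp only: power_Suc)
  ultimately have "T * n ^ (m - 2) * n ^ 2 \<le>
      (4 * real t ^ 2 * (P m + P s) * (8 * real t) ^ (m - 1) * M ^ (2 * m - 2)) * n ^ 2"
    using t0 by (simp add: power2_eq_square field_simps)
  hence "T * n ^ (m - 2) \<le> 4 * real t ^ 2 * (P m + P s) * (8 * real t) ^ (m - 1) * M ^ (2 * m - 2)"
    using n0 by (subst (asm) mult_le_cancel_right) auto
  thus ?thesis by (simp add: n_def P_def)
qed

lemma card_power_le_frac_case:
  assumes avoid: "avoid_bound 2 M" and s: "s \<ge> 3" and m: "m = (s + 1) div 2"
    and t: "t \<ge> 1" and n: "real (card V) \<ge> 8 * real t * M ^ 2"
  shows "real (card V) ^ (s + m - 3) \<le> frac_const s t * M ^ (2 * (s + m - 3) + 1)"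
proof -
  define n where "n = real (card V)"
  define P where "P r = (\<Prod>i\<in>{2<..r}. real t ^ (i - 1))" for r
  define K0 where "K0 = 2 * real t * P s * 8 ^ (s - 1)"
  define K1 where "K1 = 4 * real t ^ 2 * (P m + P s) * (8 * real t) ^ (m - 1)"
  \<comment> \<open>The threshold at which the low-degree estimate just fails for half of the
    vertices: it would give \<open>n ^ (s - 1) \<le> K0 * T * M ^ (2 * s - 3)\<close>, whose
    right-hand side is half of \<open>n ^ (s - 1)\<close>.\<close>
  define T where "T = n ^ (s - 1) / (2 * K0 * M ^ (2 * s - 3))"
  define V0 where "V0 = {v \<in> V. \<forall>a<t. real (deg a v) \<le> T}"
  define W where "W a = {v \<in> V. T < real (deg a v)}" for a
  have ms: "2 \<le> m" "m \<le> s" using s unfolding m by linarith+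
  have t0: "real t > 0" using t by simp
  have "P s > 0" unfolding P_def using t0 by (intro prod_pos) auto
  hence K0: "K0 > 0" unfolding K0_def using t0 by simp
  have "M \<le> M ^ 2" using M_ge_1 by (simp add: power2_eq_square)
  also have "M ^ 2 \<le> real t * M ^ 2" using t mult_right_mono[of 1 "real t" "M ^ 2"] by simp
  finally have M8: "8 * M \<le> n" using n by (simp add: n_def)
  have n0: "n > 0" using M8 M_ge_1 by linarith
  have T: "T > 0" unfolding T_def using n0 K0 M_ge_1 by simp
  have TK: "2 * (K0 * T * M ^ (2 * s - 3)) = n ^ (s - 1)"
    unfolding T_def using K0 M_ge_1 by simp
  have V0: "real (card V0) < n / 2"
  proof (rule ccontr)
    assume "\<not> real (card V0) < n / 2"
    hence big: "n \<le> 2 * real (card V0)" by simp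
    have "n ^ (s - 1) \<le> (2 * real (card V0)) ^ (s - 1)"
      using big n0 by (intro power_mono) auto
    also have "\<dots> = 2 ^ (s - 1) * real (card V0) ^ (s - 1)" by (simp add: power_mult_distrib)
    also have "\<dots> \<le> 2 ^ (s - 1) * (2 * real t * P s * 4 ^ (s - 1) * T * M ^ (2 * s - 3))"
      unfolding P_def
      by (intro mult_left_mono card_power_le_low_degree avoid s) (use big M8 M_ge_1 in \<open>auto simp: V0_def\<close>)
    also have "\<dots> = (2 * 4) ^ (s - 1) * (2 * real t * P s * T * M ^ (2 * s - 3))"
      unfolding power_mult_distrib by simp
    also have "\<dots> = K0 * T * M ^ (2 * s - 3)" by (simp add: K0_def)
    finally show False using TK n0 zero_less_power[OF n0, of "s - 1"] by linarith
  qed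
  \<comment> \<open>More than half of the vertices have degree above \<open>T\<close> in some
    colour, so by pigeonhole one colour accounts for at least \<open>n / (2 * t)\<close> of
    them.\<close>
  have "\<exists>a<t. n \<le> 2 * real t * real (card (W a))"
  proof (rule ccontr)
    assume "\<not> ?thesis"
    hence less: "real (card (W a)) \<le> n / (2 * real t)" if "a < t" for a
      using that t0 by (force simp: field_simps)
    have "V \<subseteq> V0 \<union> (\<Union>a<t. W a)" by (auto simp: V0_def W_def not_le)
    hence "card V \<le> card (V0 \<union> (\<Union>a<t. W a))"
      using finite_V by (intro card_mono) (auto simp: V0_def W_def)
    also have "\<dots> \<le> card V0 + card (\<Union>a<t. W a)" by (rule card_Un_le)
    also have "card (\<Union>a<t. W a) \<le> (\<Sum>a<t. card (W a))" by (rule card_UN_le) simp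
    finally have "n \<le> real (card V0) + (\<Sum>a<t. real (card (W a)))"
      unfolding n_def by (simp flip: of_nat_sum of_nat_add)
    also have "(\<Sum>a<t. real (card (W a))) \<le> (\<Sum>a<t. n / (2 * real t))"
      by (intro sum_mono less) simp
    also have "\<dots> = n / 2" using t0 by simp
    finally show False using V0 by linarith
  qed
  then obtain a where a: "a < t" "n \<le> 2 * real t * real (card (W a))" by blast
  have "T * n ^ (m - 2) \<le> K1 * M ^ (2 * m - 2)"
    unfolding n_def K1_def P_def
    by (rule card_power_le_high_degree[OF avoid s m t n T a(1)])
      (use a(2) in \<open>auto simp: W_def n_def\<close>)
  hence "2 * K0 * M ^ (2 * s - 3) * (T * n ^ (m - 2)) \<le> 2 * K0 * M ^ (2 * s - 3) * (K1 * M ^ (2 * m - 2))"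
    using K0 M_ge_1 by (intro mult_left_mono) auto
  hence "n ^ (s - 1) * n ^ (m - 2) \<le> 2 * K0 * K1 * (M ^ (2 * s - 3) * M ^ (2 * m - 2))"
    unfolding TK[symmetric] by (simp add: mult_ac)
  moreover have exps: "s + m - 3 = (s - 1) + (m - 2)" "2 * (s + m - 3) + 1 = (2 * s - 3) + (2 * m - 2)"
    using s ms by auto
  have "n ^ (s + m - 3) = n ^ (s - 1) * n ^ (m - 2)"
    "M ^ (2 * (s + m - 3) + 1) = M ^ (2 * s - 3) * M ^ (2 * m - 2)"
    by (simp only: exps(1) power_add, simp only: exps(2) power_add)
  moreover have "frac_const s t = 2 * K0 * K1"
    by (simp add: frac_const_def Let_def K0_def K1_def P_def m)
  ultimately show ?thesis by (simp add: n_def)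
qed

end

subsection \<open>Exponents\<close>

lemma alpha_boundI:
  assumes "s \<ge> 2" "C > 0"
    and "\<And>(V::nat set) E c M. bounded_clique_free V E c t s M \<Longrightarrow> real (card V) \<le> C * M powr e"
  shows "alpha_bound s t e C"
  unfolding alpha_bound_def
proof (intro conjI allI impI)
  fix V :: "nat set" and E M
  assume *: "finite V" "E \<subseteq> nsets V 2" "K3_free_colorable t E" "M \<ge> 1"
    "\<forall>S\<subseteq>V. clique_free s S E \<longrightarrow> real (card S) \<le> M"
  then obtain c where "c \<in> E \<rightarrow> {..<t}" "\<not> mono_triangle E c"
    unfolding K3_free_colorable_def by blast
  hence "bounded_clique_free V E c t s M"
    by unfold_locales (use * assms(1) in auto)
  thus "real (card V) \<le> C * M powr e" by (rule assms(3))
qed (rule assms(2))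

lemma alpha_boundD:
  fixes V :: "nat set"
  assumes "alpha_bound s t e C" "finite V" "E \<subseteq> nsets V 2" "K3_free_colorable t E" "M \<ge> 1"
    and "\<And>S. S \<subseteq> V \<Longrightarrow> clique_free s S E \<Longrightarrow> real (card S) \<le> M"
  shows "real (card V) \<le> C * M powr e"
  using assms unfolding alpha_bound_def by blast

text \<open>The induction hypothesis for \<open>t - k\<close> colours is applied to the graph
  induced on \<open>N\<close>; the same \<open>M\<close> serves there, since clique-free subsets of
  \<open>N\<close> are clique-free in the whole graph.\<close>

lemma avoid_bound_alpha_bound:
  fixes V :: "nat set"
  assumes "bounded_clique_free V E c t s M" and ab: "alpha_bound s (t - k) e C"
  shows "triangle_free_coloring.avoid_bound V E c t k (C * M powr e)"
proof -
  interpret bounded_clique_free V E c t s M by fact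
  show ?thesis
    unfolding avoid_bound_def
  proof (intro conjI allI impI)
    show "0 \<le> C * M powr e" using ab by (simp add: alpha_bound_def)
    fix N A assume A: "N \<subseteq> V" "A \<subseteq> {..<t}" "k \<le> card A"
      "\<forall>x\<in>N. \<forall>y\<in>N. {x, y} \<in> E \<longrightarrow> c {x, y} \<notin> A"
    hence "K3_free_colorable (t - k) (E \<inter> nsets N 2)"
      by (intro colorable_avoiding[OF A(2,3)]) simp
    moreover have "finite N" using A(1) finite_V by (rule finite_subset)
    moreover have "real (card S) \<le> M" if "S \<subseteq> N" "clique_free s S (E \<inter> nsets N 2)" for S
      using card_le_M[of S] clique_free_Int_nsets[OF that(2,1)] that(1) A(1) by blast
    ultimately show "real (card N) \<le> C * M powr e"
      by (intro alpha_boundD[OF ab, where E = "E \<inter> nsets N 2"] M_ge_1) auto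
  qed
qed

lemma le_of_power_le:
  fixes n K M x :: real
  assumes "n \<ge> 0" "K > 0" "M > 0" "L \<ge> 1" and le: "n ^ L \<le> K * M powr x"
  shows "n \<le> K powr (1 / real L) * M powr (x / real L)"
proof (cases "n = 0")
  case False
  hence n: "n > 0" using assms(1) by simp
  have "n = (n ^ L) powr (1 / real L)"
    using n assms(4) by (simp add: powr_realpow[symmetric] powr_powr)
  also have "\<dots> \<le> (K * M powr x) powr (1 / real L)"
    using n by (intro powr_mono2 le) auto
  also have "\<dots> = K powr (1 / real L) * M powr (x / real L)"
    using assms(2,3) by (simp add: powr_mult powr_powr)
  finally show ?thesis .
qed (use assms in simp)

section \<open>The four branches of the recursion\<close>

lemma alpha_bound_of_ramsey3_le:
  assumes "s \<ge> 2" "ramsey3 t \<le> s"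
  shows "alpha_bound s t 1 1"
proof (rule alpha_boundI)
  fix V :: "nat set" and E c M assume "bounded_clique_free V E c t s M"
  then interpret bounded_clique_free V E c t s M .
  have "clique_free s V E"
    using assms by (intro clique_free_of_ramsey3_le[OF colorable]) auto
  thus "real (card V) \<le> 1 * M powr 1"
    using card_le_M M_ge_1 by simp
qed (use assms in auto)

lemma alpha_bound_sqrt_case:
  assumes "s \<ge> 2" "t \<ge> 1" "ramsey3 (t - 1) \<le> s"
  shows "alpha_bound s t 2 (8 * real t)"
proof (rule alpha_boundI)
  fix V :: "nat set" and E c M assume "bounded_clique_free V E c t s M"
  then interpret bounded_clique_free V E c t s M .
  show "real (card V) \<le> 8 * real t * M powr 2"
    using card_le_sqrt_case[OF assms(2) avoid_bound_ramsey3[OF assms(3)]] M_ge_1 by simp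
qed (use assms in auto)

lemma frac_const_pos:
  assumes "t \<ge> 1"
  shows "frac_const s t > 0"
proof -
  have "(\<Prod>i\<in>{2<..r}. real t ^ (i - 1)) > 0" for r
    using assms by (intro prod_pos) auto
  thus ?thesis
    using assms unfolding frac_const_def Let_def by (intro mult_pos_pos add_pos_pos) auto
qed

text \<open>The exponent is \<open>(2 * L + 1) / L\<close>, obtained as an \<open>L\<close>-th root.
  If \<open>card V\<close> is below \<open>8 * t * M ^ 2\<close>, exponent 2 already
  suffices.\<close>

lemma alpha_bound_frac_case:
  assumes s: "s \<ge> 3" and t: "t \<ge> 1" and r: "ramsey3 (t - 2) \<le> s" and L: "L = s + (s + 1) div 2 - 3"
  shows "\<exists>C. alpha_bound s t (2 + 1 / real L) C"
proof
  let ?K = "frac_const s t powr (1 / real L)"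
  have L1: "L \<ge> 1" using s unfolding L by linarith
  show "alpha_bound s t (2 + 1 / real L) (8 * real t + ?K)"
  proof (rule alpha_boundI)
    fix V :: "nat set" and E c M assume "bounded_clique_free V E c t s M"
    then interpret bounded_clique_free V E c t s M .
    have M0: "M > 0" using M_ge_1 by simp
    have avoid: "avoid_bound 2 M" using r by (rule avoid_bound_ramsey3)
    have "real (card V) \<le> 8 * real t * M powr (2 + 1 / real L) \<or> real (card V) \<le> ?K * M powr (2 + 1 / real L)"
    proof (cases "real (card V) \<ge> 8 * real t * M ^ 2")
      case True
      have "real (card V) ^ L \<le> frac_const s t * M ^ (2 * L + 1)"
        unfolding L by (rule card_power_le_frac_case[OF avoid s refl t True])
      also have "M ^ (2 * L + 1) = M powr (2 * real L + 1)"
        using M0 powr_realpow[OF M0, of "2 * L + 1"] by (simp add: add.commute)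
      finally have "real (card V) \<le> ?K * M powr ((2 * real L + 1) / real L)"
        using frac_const_pos[OF t] M0 L1 by (intro le_of_power_le) auto
      moreover have "(2 * real L + 1) / real L = 2 + 1 / real L" using L1 by (simp add: field_simps)
      ultimately show ?thesis by simp
    next
      case False
      have "M ^ 2 = M powr 2" using M0 by simp
      also have "\<dots> \<le> M powr (2 + 1 / real L)" using M_ge_1 by (intro powr_mono) auto
      finally have "8 * real t * M ^ 2 \<le> 8 * real t * M powr (2 + 1 / real L)"
        by (intro mult_left_mono) auto
      thus ?thesis using False by linarith
    qed
    moreover have "8 * real t * M powr (2 + 1 / real L) \<ge> 0" "?K * M powr (2 + 1 / real L) \<ge> 0" by auto
    ultimately show "real (card V) \<le> (8 * real t + ?K) * M powr (2 + 1 / real L)"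
      unfolding distrib_right by linarith
  qed (use s t in \<open>auto intro: add_pos_nonneg\<close>)
qed

lemma alpha_bound_rec_case:
  assumes s: "s \<ge> 2" and t: "t \<ge> 1" and e: "\<And>i. i \<in> {2..s} \<Longrightarrow> e i \<ge> 0"
    and ab: "\<And>i. i \<in> {2..s} \<Longrightarrow> \<exists>C. alpha_bound s (t - g_loc i) (e i) C"
  shows "\<exists>C. alpha_bound s t (1 + 1 / (real s - 1) * (\<Sum>i=2..s. e i)) C"
proof -
  obtain C where C: "\<And>i. i \<in> {2..s} \<Longrightarrow> alpha_bound s (t - g_loc i) (e i) (C i)"
    using ab by metis
  define K where "K = 2 * (\<Prod>i=2..s. real t ^ (i - 1) * C i) * 4 ^ (s - 1)"
  define x where "x = (\<Sum>i=2..s. e i)"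
  define y where "y = 1 + 1 / (real s - 1) * x"
  have "(\<Prod>i=2..s. real t ^ (i - 1) * C i) > 0"
    using t C by (intro prod_pos) (auto simp: alpha_bound_def)
  hence K: "K > 0" by (simp add: K_def)
  have "x \<ge> 0" unfolding x_def by (intro sum_nonneg e)
  hence y: "y \<ge> 1" using s by (simp add: y_def)
  have "alpha_bound s t y (2 + K powr (1 / real (s - 1)))"
  proof (rule alpha_boundI)
    fix V :: "nat set" and E c M assume bcf: "bounded_clique_free V E c t s M"
    then interpret bounded_clique_free V E c t s M .
    have M0: "M > 0" using M_ge_1 by simp
    have "real (card V) \<le> 2 * M powr y \<or> real (card V) \<le> K powr (1 / real (s - 1)) * M powr y"
    proof (cases "real (card V) \<ge> 2 * M")
      case True
      have "real (card V) ^ (s - 1) \<le>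
          2 * (\<Prod>i=2..s. real t ^ (i - 1) * (C i * M powr e i)) * (4 * M) ^ (s - 1)"
        by (intro card_power_le_rec_case True avoid_bound_alpha_bound[OF bcf] C)
      also have "(\<Prod>i=2..s. real t ^ (i - 1) * (C i * M powr e i)) =
          (\<Prod>i=2..s. real t ^ (i - 1) * C i) * M powr x"
        using M0 by (simp add: prod.distrib x_def powr_sum mult_ac)
      also have "2 * ((\<Prod>i=2..s. real t ^ (i - 1) * C i) * M powr x) * (4 * M) ^ (s - 1) =
          K * (M powr x * M ^ (s - 1))"
        by (simp add: K_def power_mult_distrib mult_ac)
      also have "M powr x * M ^ (s - 1) = M powr (x + real (s - 1))"
        using M0 by (simp add: powr_add powr_realpow)
      finally have "real (card V) \<le> K powr (1 / real (s - 1)) * M powr ((x + real (s - 1)) / real (s - 1))"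
        using K M0 s by (intro le_of_power_le) auto
      moreover have "(x + real (s - 1)) / real (s - 1) = y"
        using s by (simp add: y_def field_simps of_nat_diff)
      ultimately show ?thesis by simp
    next
      case False
      have "M = M powr 1" using M0 by simp
      also have "\<dots> \<le> M powr y" using M_ge_1 y by (intro powr_mono) auto
      finally show ?thesis using False by linarith
    qed
    moreover have "2 * M powr y \<ge> 0" "K powr (1 / real (s - 1)) * M powr y \<ge> 0" by auto
    ultimately show "real (card V) \<le> (2 + K powr (1 / real (s - 1))) * M powr y"
      unfolding distrib_right by linarith
  qed (use s in \<open>auto intro: add_pos_nonneg\<close>)
  thus ?thesis unfolding y_def x_def by blast
qed

lemma ex_alpha_bound_a_seq:
  assumes s: "s \<ge> 2"
  shows "\<exists>C. alpha_bound s t (1 / a_seq s t) C"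
proof (induction t rule: less_induct)
  case (less t)
  have t: "t \<ge> 1" if "s < ramsey3 t" using that s ramsey3_0 by (cases "t = 0") auto
  have t': "t \<ge> 2" if "s < ramsey3 (t - 1)" using that s ramsey3_0 by (cases "t \<le> 1") auto
  consider (one) "ramsey3 t \<le> s" | (half) "t \<ge> 1" "ramsey3 (t - 1) \<le> s" "s < ramsey3 t"
    | (frac) "t \<ge> 2" "ramsey3 (t - 2) \<le> s" "s < ramsey3 (t - 1)" "s \<ge> 3"
    | (rec) "(t \<ge> 2 \<and> 3 \<le> s \<and> s < ramsey3 (t - 2)) \<or> (t \<ge> 1 \<and> s = 2 \<and> s < ramsey3 (t - 1))"
    using s t t'
    by (cases "ramsey3 t \<le> s"; cases "ramsey3 (t - 1) \<le> s"; cases "s = 2"; cases "ramsey3 (t - 2) \<le> s")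
      (auto simp: not_le)
  thus ?case
  proof cases
    case one
    thus ?thesis using alpha_bound_of_ramsey3_le[OF s one] by (auto simp: a_seq_eq_1)
  next
    case half
    thus ?thesis using alpha_bound_sqrt_case[OF s half(1,2)] by (auto simp: a_seq_eq_half)
  next
    case frac
    define L where "L = s + (s + 1) div 2 - 3"
    have L1: "L \<ge> 1" using frac(4) unfolding L_def by linarith
    have "\<lceil>real s / 2\<rceil> = int ((s + 1) div 2)"
      by (cases "even s") (auto elim!: evenE oddE simp: ceiling_eq_iff)
    moreover have "real L = real s + real ((s + 1) div 2) - 3"
      using frac(4) unfolding L_def by (subst of_nat_diff) auto
    ultimately have "a_seq s t = real L / (2 * real L + 1)"
      by (simp add: a_seq_eq_frac[OF frac])
    hence "1 / a_seq s t = (2 * real L + 1) / real L" by simp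
    also have "\<dots> = 2 + 1 / real L" using L1 by (simp add: field_simps)
    finally have "1 / a_seq s t = 2 + 1 / real L" .
    thus ?thesis using alpha_bound_frac_case[OF frac(4) _ frac(2) L_def] frac(1) by simp
  next
    case rec
    hence t: "t \<ge> 1" by linarith
    have "\<exists>C. alpha_bound s t (1 + 1 / (real s - 1) * (\<Sum>i=2..s. 1 / a_seq s (t - g_loc i))) C"
    proof (rule alpha_bound_rec_case[OF s t])
      fix i assume i: "i \<in> {2..s}"
      show "0 \<le> 1 / a_seq s (t - g_loc i)" using a_seq_pos[OF s, of "t - g_loc i"] by simp
      show "\<exists>C. alpha_bound s (t - g_loc i) (1 / a_seq s (t - g_loc i)) C"
        \<comment> \<open>For \<open>i \<ge> 2\<close> the number \<open>g_loc i\<close> is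
          positive, so \<open>t - g_loc i\<close> is smaller than \<open>t\<close>.\<close>
        using i t g_loc_pos[of i] by (intro less) auto
    qed
    thus ?thesis by (simp only: a_seq_eq_rec(1)[OF rec])
  qed
qed

section \<open>From the bound on the number of vertices to \<open>f_alpha\<close>\<close>

lemma f_alpha_ge:
  assumes s: "s \<ge> 2" and ab: "alpha_bound s t e C" and n: "n \<ge> 1"
  shows "real n \<le> C * real (f_alpha s t n) powr e"
proof -
  define Es where "Es = {E. E \<subseteq> nsets {..<n} 2 \<and> K3_free_colorable t E}"
  have "finite Es"
    by (rule finite_subset[of _ "Pow (nsets {..<n} 2)"]) (auto simp: Es_def finite_imp_finite_nsets)
  moreover have "{} \<in> Es" by (auto simp: Es_def K3_free_colorable_def mono_triangle_def)
  ultimately have "f_alpha s t n \<in> alpha s {..<n} ` Es"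
    unfolding f_alpha_def Es_def[symmetric] by (intro Min_in) auto
  then obtain E where E: "E \<in> Es" "f_alpha s t n = alpha s {..<n} E" by blast
  have le: "card S \<le> f_alpha s t n" if "S \<subseteq> {..<n}" "clique_free s S E" for S
    unfolding E(2) alpha_def by (rule Max_ge) (use that in \<open>auto simp: clique_free_def\<close>)
  \<comment> \<open>A single vertex contains no \<open>s\<close>-clique, which gives the condition
    \<open>M \<ge> 1\<close> for \<open>M = f_alpha s t n\<close>.\<close>
  have "clique_free s {0} E" using s by (auto simp: clique_free_def nsets_singleton_iff)
  hence "1 \<le> f_alpha s t n" using le[of "{0}"] n by simp
  hence "real (card {..<n}) \<le> C * real (f_alpha s t n) powr e"
    by (intro alpha_boundD[OF ab, where E = E]) (use E(1) le in \<open>auto simp: Es_def\<close>)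
  thus ?thesis by simp
qed

theorem theorem1p3:
  fixes s t :: nat
  assumes "s \<ge> 2" and "t \<ge> 1"
  shows "(\<lambda>n. real (f_alpha s t n)) \<in> \<Omega>(\<lambda>n. real n powr a_seq s t)"
proof -
  define a where "a = a_seq s t"
  have a: "a > 0" using a_seq_pos[OF assms(1)] by (simp add: a_def)
  obtain C where C: "alpha_bound s t (1 / a) C"
    using ex_alpha_bound_a_seq[OF assms(1)] unfolding a_def by blast
  hence C0: "C > 0" by (simp add: alpha_bound_def)
  \<comment> \<open>The constant \<open>C powr - a\<close> results from solving
    \<open>n \<le> C * f powr (1 / a)\<close> for \<open>f\<close>.\<close>
  have "real (f_alpha s t n) \<ge> C powr - a * real n powr a" if "n \<ge> 1" for n
  proof -
    have "real n powr a \<le> (C * real (f_alpha s t n) powr (1 / a)) powr a"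
      using f_alpha_ge[OF assms(1) C that] a by (intro powr_mono2) auto
    also have "\<dots> = C powr a * real (f_alpha s t n)"
      using C0 a by (simp add: powr_mult powr_powr)
    finally show ?thesis using C0 by (simp add: powr_minus field_simps)
  qed
  thus ?thesis
    unfolding a_def using C0
    by (intro landau_omega.bigI[of "C powr - a_seq s t"] eventually_sequentiallyI[of 1]) auto
qed

end
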